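(* Let $(M_i)_{i=1}^n$ be a sequence of $p\times p$ positive semi-definite random matrices with $\mathbb{E}[M_i]=\Sigma$ for all $i=1,\ldots,n$. Suppose that for some $K>0$, for all $p\times p$ positive semi-definite matrices $A$ and for all $\tau\in(-\infty,1/(2\|A\|K))$, $$\mathbb{E}\left[\exp\left(\tau\sum_{i=1}^n\mathrm{Tr}\left(A\left((\Sigma^\dagger)^{1/2}M_i(\Sigma^\dagger)^{1/2}-\mathbb{E}[(\Sigma^\dagger)^{1/2}M_i(\Sigma^\dagger)^{1/2}]\right)\right)\right)\right]\le\exp\left(\frac{2\|A\|K\tau^2}{1-2\|A\|K\tau}\,n\,\mathrm{Tr}(A)\right).$$ Then, for any $t\ge 0$ and positive integer $n$ satisfying $n\ge 2K(9\,\mathbf{r}(\Sigma)+4t)$, with probability at least $1-\exp(-t)$, $$\left\|\frac1n\sum_{i=1}^n M_i-\Sigma\right\|\le 12\sqrt{K}\,\|\Sigma\|\sqrt{\frac{9\,\mathbf{r}(\Sigma)+4t}{n}}.$$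
   Context: $\|\cdot\|$ is the $\ell^2\to\ell^2$ operator norm for matrices. $M^\dagger$ is the Moore--Penrose inverse of $M$. For a positive semi-definite matrix $M$, the effective rank is $\mathbf{r}(M)=\mathrm{Tr}(M)/\|M\|$ if $\|M\|>0$ and $\mathbf{r}(M)=0$ otherwise. Positive semi-definite matrices are real symmetric. When $A=0$, $1/(2\|A\|K)$ is read as $+\infty$. No independence of the $M_i$ is assumed. *)

theory Defs
  imports "HOL-Probability.Probability"
begin

abbreviation opnorm :: "real^'n^'m \<Rightarrow> real" where
  "opnorm A \<equiv> onorm (\<lambda>x. A *v x)"

definition psd :: "real^'n^'n \<Rightarrow> bool" where
  "psd A \<longleftrightarrow> transpose A = A \<and> (\<forall>x. 0 \<le> x \<bullet> (A *v x))"

text \<open>The Moore--Penrose inverse, as the unique solution of the four Penrose equations.\<close>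

definition is_pinv :: "real^'n^'m \<Rightarrow> real^'m^'n \<Rightarrow> bool" where
  "is_pinv A X \<longleftrightarrow>
     A ** X ** A = A \<and> X ** A ** X = X \<and>
     transpose (A ** X) = A ** X \<and> transpose (X ** A) = X ** A"

definition pinv :: "real^'n^'m \<Rightarrow> real^'m^'n" where
  "pinv A = (THE X. is_pinv A X)"

text \<open>The unique positive semi-definite square root; only meaningful for \<open>psd A\<close>.\<close>

definition psd_sqrt :: "real^'n^'n \<Rightarrow> real^'n^'n" where
  "psd_sqrt A = (THE S. psd S \<and> S ** S = A)"

definition eff_rank :: "real^'n^'n \<Rightarrow> real" where
  "eff_rank A = (if opnorm A > 0 then trace A / opnorm A else 0)"

end

theory Submission
  imports Defs
begin

text \<open>
  The proof is the PAC-Bayesian (variational) argument. Let \<open>S\<close> be the square root of \<open>\<Sigma>\<close> and let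
  \<open>W\<close> be the sum of the centred whitened matrices. Each random matrix almost surely annihilates the
  kernel of \<open>\<Sigma>\<close> (\<open>AE_absorbs_range_projection\<close>), so \<open>n\<close> times the deviation is \<open>S ** W ** S\<close>, and its
  operator norm is the supremum over unit vectors \<open>u\<close> of the absolute value of the quadratic form of
  \<open>W\<close> at \<open>S *v u\<close>.

  For one fixed direction the hypothesis, applied to a rank one matrix, gives a Bernstein
  tail. To treat all directions at once without a net, whose cardinality would depend on the
  dimension, \<open>u\<close> is replaced by a random vector \<open>u + h\<close>, where \<open>h\<close> is Gaussian of precision
  \<open>\<beta>\<close>, conditioned on \<open>S *v h\<close> being short (\<open>truncated_gauss\<close>). Since all these laws have bounded
  entropy relative to one common Gaussian measure, Jensen's inequality bounds the exponential of
  the averaged form by the integral of the exponential of the form against that measure, which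
  does not depend on \<open>u\<close> (\<open>pac_bayes_quadratic\<close>) and whose expectation the hypothesis controls
  (\<open>trace_bernstein_uniform\<close> and Tonelli's theorem). The mean squared length of \<open>S *v h\<close> is
  \<open>trace \<Sigma> / \<beta>\<close> and the entropy cost is \<open>\<beta> / 2\<close>; balancing them by taking \<open>\<beta>\<close> proportional to the
  effective rank is what makes the bound dimension-free.

  Averaging over \<open>h\<close> also adds \<open>trace (C ** W)\<close>, where \<open>C\<close> is the second moment matrix of
  \<open>S *v h\<close>. It is the same for all \<open>u\<close>, and the hypothesis, which covers every positive
  semi-definite matrix and both signs of \<open>\<tau>\<close>, bounds it directly with \<open>A = C\<close>. The bookkeeping of
  constants is in \<open>uniform_quadratic_deviation\<close>.
\<close>

section \<open>The spectral theorem and whitening\<close>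

lemma quadratic_bound_imp_zero:
  fixes a k :: real
  assumes "\<And>t. 2 * t * a \<le> t\<^sup>2 * k"
  shows "a = 0"
proof -
  define m where "m = \<bar>k\<bar> + 1"
  have m: "m > 0" by (simp add: m_def)
  have "2 * (a / m) * a * m\<^sup>2 \<le> (a / m)\<^sup>2 * k * m\<^sup>2"
    using assms[of "a / m"] by (intro mult_right_mono) auto
  moreover have "2 * (a / m) * a * m\<^sup>2 = 2 * a\<^sup>2 * m" "(a / m)\<^sup>2 * k * m\<^sup>2 = a\<^sup>2 * k"
    using m by (simp_all add: power2_eq_square)
  ultimately have "2 * a\<^sup>2 * (\<bar>k\<bar> + 1) \<le> a\<^sup>2 * k" unfolding m_def by linarith
  moreover have "a\<^sup>2 * k \<le> a\<^sup>2 * \<bar>k\<bar>" by (intro mult_left_mono) auto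
  ultimately have "a\<^sup>2 * \<bar>k\<bar> + 2 * a\<^sup>2 \<le> 0" by (simp add: algebra_simps)
  moreover have "a\<^sup>2 * \<bar>k\<bar> \<ge> 0" by simp
  ultimately have "a\<^sup>2 \<le> 0" by linarith
  then show ?thesis by simp
qed

lemma inner_matrix_transpose:
  fixes A :: "real^'n^'m"
  shows "x \<bullet> (A *v y) = (transpose A *v x) \<bullet> y"
  by (simp add: dot_lmul_matrix)

lemma symmetric_inner:
  fixes A :: "real^'n^'n"
  assumes "transpose A = A"
  shows "x \<bullet> (A *v y) = (A *v x) \<bullet> y"
  by (metis assms inner_matrix_transpose)

text \<open>The maximiser \<open>x\<close> of the quadratic form on the unit sphere of \<open>V\<close> is an
eigenvector: perturbing it in a direction \<open>w\<close> orthogonal to it changes the form by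
\<open>2 * t * (w \<bullet> (A *v x))\<close> to first order, so this inner product vanishes. By symmetry the
orthogonal complement of \<open>x\<close> in \<open>V\<close> is again invariant, and the induction continues there.\<close>

lemma symmetric_eigenbasis_subspace:
  fixes A :: "real^'n^'n"
  assumes sym: "transpose A = A"
  shows "subspace V \<Longrightarrow> (\<forall>x\<in>V. A *v x \<in> V) \<Longrightarrow>
    \<exists>B. finite B \<and> B \<subseteq> V \<and> pairwise orthogonal B \<and>
      (\<forall>b\<in>B. norm b = 1 \<and> (\<exists>c. A *v b = c *\<^sub>R b)) \<and> span B = V"
proof (induction "dim V" arbitrary: V rule: less_induct)
  case less
  note V = less.prems(1) and inv = less.prems(2)
  show ?case
  proof (cases "V = {0}")
    case True
    then show ?thesis by (intro exI[of _ "{}"]) auto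
  next
    case False
    then obtain v where v: "v \<in> V" "v \<noteq> 0" using subspace_0[OF V] by auto
    let ?S = "sphere 0 1 \<inter> V"
    have compact: "compact ?S" by (intro compact_Int_closed closed_subspace V compact_sphere)
    have "v /\<^sub>R norm v \<in> ?S" using v by (auto intro: subspace_scale[OF V])
    then have nonempty: "?S \<noteq> {}" by blast
    have "continuous_on ?S (\<lambda>x. x \<bullet> (A *v x))"
      by (intro continuous_intros linear_continuous_on matrix_vector_mul_bounded_linear)
    from continuous_attains_sup[OF compact nonempty this]
    obtain x where x: "x \<in> ?S" and mx: "\<And>y. y \<in> ?S \<Longrightarrow> y \<bullet> (A *v y) \<le> x \<bullet> (A *v x)"
      by blast
    define c where "c = x \<bullet> (A *v x)"
    have xV: "x \<in> V" and nx: "norm x = 1" "x \<bullet> x = 1" using x by (auto simp: norm_eq_1)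
    have bnd: "y \<bullet> (A *v y) \<le> c * (y \<bullet> y)" if "y \<in> V" for y
    proof (cases "y = 0")
      case False
      have "y /\<^sub>R norm y \<in> ?S" using that False by (auto intro: subspace_scale[OF V])
      from mx[OF this] have "inverse (norm y) * (inverse (norm y) * (y \<bullet> (A *v y))) \<le> c"
        by (simp add: c_def matrix_vector_mult_scaleR)
      then have "(norm y)\<^sup>2 * (inverse (norm y) * (inverse (norm y) * (y \<bullet> (A *v y)))) \<le> (norm y)\<^sup>2 * c"
        by (intro mult_left_mono) auto
      moreover have "(norm y)\<^sup>2 * (inverse (norm y) * (inverse (norm y) * (y \<bullet> (A *v y)))) = y \<bullet> (A *v y)"
        using False by (simp add: power2_eq_square field_simps)
      ultimately show ?thesis by (simp add: dot_square_norm mult.commute)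
    qed auto
    have orth: "w \<bullet> (A *v x) = 0" if "w \<in> V" "w \<bullet> x = 0" for w
    proof (rule quadratic_bound_imp_zero)
      fix t :: real
      have "x + t *\<^sub>R w \<in> V" using V xV that by (auto intro: subspace_add subspace_scale)
      from bnd[OF this] show "2 * t * (w \<bullet> (A *v x)) \<le> t\<^sup>2 * (c * (w \<bullet> w) - w \<bullet> (A *v w))"
        using nx that symmetric_inner[OF sym, of x w]
        by (simp add: matrix_vector_right_distrib matrix_vector_mult_scaleR inner_simps c_def
            power2_eq_square algebra_simps inner_commute)
    qed
    have eig: "A *v x = c *\<^sub>R x"
    proof -
      let ?w = "A *v x - c *\<^sub>R x"
      have "?w \<in> V" using V xV inv by (auto intro: subspace_diff subspace_scale)
      moreover have wx: "?w \<bullet> x = 0" using nx by (simp add: inner_simps c_def inner_commute)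
      ultimately have "?w \<bullet> (A *v x) = 0" by (rule orth)
      then have "?w \<bullet> ?w = 0" using wx by (simp add: inner_diff_right)
      then show ?thesis by simp
    qed
    let ?V' = "{y \<in> V. x \<bullet> y = 0}"
    have V': "subspace ?V'" using V by (auto simp: subspace_def inner_simps)
    have "x \<notin> ?V'" using nx by simp
    then have "?V' \<subset> V" using xV by blast
    then have "dim ?V' < dim V" by (simp add: V V' dim_psubset span_eq_iff[THEN iffD2])
    moreover have "\<forall>y\<in>?V'. A *v y \<in> ?V'"
      using inv by (auto simp: symmetric_inner[OF sym] eig)
    ultimately obtain B where B: "finite B" "B \<subseteq> ?V'" "pairwise orthogonal B"
      "\<forall>b\<in>B. norm b = 1 \<and> (\<exists>c. A *v b = c *\<^sub>R b)" "span B = ?V'"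
      using less.hyps V' by (metis (no_types, lifting))
    show ?thesis
    proof (intro exI[of _ "insert x B"] conjI)
      show "pairwise orthogonal (insert x B)"
        using B(2,3) by (auto simp: pairwise_insert orthogonal_def inner_commute)
      show "\<forall>b\<in>insert x B. norm b = 1 \<and> (\<exists>c. A *v b = c *\<^sub>R b)" using B(4) nx eig by auto
      show "span (insert x B) = V"
      proof
        show "span (insert x B) \<subseteq> V" using B xV V by (intro span_minimal) auto
        show "V \<subseteq> span (insert x B)"
        proof
          fix y assume y: "y \<in> V"
          have "y - (x \<bullet> y) *\<^sub>R x \<in> ?V'" using V y xV nx
            by (auto intro: subspace_diff subspace_scale simp: inner_simps)
          then show "y \<in> span (insert x B)" using B(5) span_insert by blast
        qed
      qed
    qed (use B xV in auto)
  qed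
qed

definition onb :: "('a::euclidean_space) set \<Rightarrow> bool" where
  "onb B \<longleftrightarrow> finite B \<and> pairwise orthogonal B \<and> (\<forall>b\<in>B. norm b = 1) \<and> span B = UNIV"

text \<open>Functional calculus: every function of a fixed symmetric matrix (its square root, its
pseudo-inverse) has this form over one common eigenbasis \<open>B\<close>, so identities between such
functions reduce to identities between eigenvalues.\<close>

definition spectral_matrix :: "(real^'n) set \<Rightarrow> (real^'n \<Rightarrow> real) \<Rightarrow> real^'n^'n" where
  "spectral_matrix B f = matrix (\<lambda>x. \<Sum>b\<in>B. (f b * (b \<bullet> x)) *\<^sub>R b)"

lemma spectral_matrix_mult_vec:
  "spectral_matrix B f *v x = (\<Sum>b\<in>B. (f b * (b \<bullet> x)) *\<^sub>R b)"
  unfolding spectral_matrix_def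
proof -
  have "linear (\<lambda>x. \<Sum>b\<in>B. (f b * (b \<bullet> x)) *\<^sub>R b)"
    by (intro linear_compose_sum ballI linearI) (auto simp: inner_simps algebra_simps)
  then show "matrix (\<lambda>x. \<Sum>b\<in>B. (f b * (b \<bullet> x)) *\<^sub>R b) *v x = (\<Sum>b\<in>B. (f b * (b \<bullet> x)) *\<^sub>R b)"
    by (intro matrix_works) (simp add: linear_def scalar_mult_eq_scaleR[abs_def])
qed

lemma spectral_matrix_basis:
  assumes "onb B" "b \<in> B"
  shows "spectral_matrix B f *v b = f b *\<^sub>R b"
proof -
  have "b' \<bullet> b = (if b' = b then 1 else 0)" if "b' \<in> B" for b'
    using assms that by (auto simp: onb_def pairwise_def orthogonal_def norm_eq_1)
  then have "(\<Sum>b'\<in>B. (f b' * (b' \<bullet> b)) *\<^sub>R b') = (\<Sum>b'\<in>B. if b' = b then f b *\<^sub>R b else 0)"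
    by (intro sum.cong) auto
  then show ?thesis using assms by (simp add: spectral_matrix_mult_vec onb_def)
qed

lemma matrix_eq_on_onb:
  fixes A C :: "real^'n^'m"
  assumes "onb B" "\<And>b. b \<in> B \<Longrightarrow> A *v b = C *v b"
  shows "A = C"
proof -
  have "A *v x = C *v x" for x
    using linear_eq_on_span[of "(*v) A" "(*v) C" B x] assms by (auto simp: onb_def)
  then show ?thesis by (simp add: matrix_eq)
qed

lemma spectral_matrix_mult:
  assumes "onb B"
  shows "spectral_matrix B f ** spectral_matrix B g = spectral_matrix B (\<lambda>b. f b * g b)"
  by (rule matrix_eq_on_onb[OF assms])
     (simp add: matrix_vector_mul_assoc[symmetric] spectral_matrix_basis[OF assms] matrix_vector_mult_scaleR)

lemma transpose_spectral_matrix: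
  fixes B :: "(real^'n) set"
  shows "transpose (spectral_matrix B f) = spectral_matrix B f"
proof -
  have "(transpose (spectral_matrix B f) *v x) \<bullet> y = (spectral_matrix B f *v x) \<bullet> y" for x y :: "real^'n"
    unfolding inner_matrix_transpose[symmetric]
    by (simp add: spectral_matrix_mult_vec inner_sum_left inner_sum_right mult_ac inner_commute)
  then have "transpose (spectral_matrix B f) *v x = spectral_matrix B f *v x" for x :: "real^'n"
    by (metis vector_eq_rdot)
  then show ?thesis by (simp add: matrix_eq)
qed

lemma psd_spectral_matrix:
  fixes B :: "(real^'n) set"
  assumes "\<And>b. b \<in> B \<Longrightarrow> f b \<ge> 0"
  shows "psd (spectral_matrix B f)"
  unfolding psd_def
proof (intro conjI allI transpose_spectral_matrix)
  fix x :: "real^'n"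
  have "x \<bullet> (spectral_matrix B f *v x) = (\<Sum>b\<in>B. f b * (b \<bullet> x)\<^sup>2)"
    by (simp add: spectral_matrix_mult_vec inner_sum_right power2_eq_square inner_commute mult.assoc)
  also have "\<dots> \<ge> 0" using assms by (intro sum_nonneg mult_nonneg_nonneg) auto
  finally show "0 \<le> x \<bullet> (spectral_matrix B f *v x)" .
qed

lemma psd_spectral_decomposition:
  fixes A :: "real^'n^'n"
  assumes "psd A"
  obtains B l where "onb B" "\<And>b. b \<in> B \<Longrightarrow> l b \<ge> 0" "A = spectral_matrix B l"
proof -
  obtain B where B: "finite B" "pairwise orthogonal B" "\<forall>b\<in>B. norm b = 1 \<and> (\<exists>c. A *v b = c *\<^sub>R b)" "span B = UNIV"
    using symmetric_eigenbasis_subspace[of A UNIV] assms by (auto simp: psd_def)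
  then have onb: "onb B" by (auto simp: onb_def)
  define l where "l b = b \<bullet> (A *v b)" for b
  have nonneg: "l b \<ge> 0" for b using assms by (auto simp: psd_def l_def)
  have "A *v b = l b *\<^sub>R b" if b: "b \<in> B" for b
  proof -
    obtain c where c: "A *v b = c *\<^sub>R b" using B(3) b by blast
    moreover have "b \<bullet> b = 1" using B(3) b norm_eq_1 by blast
    ultimately have "l b = c" by (simp add: l_def)
    then show ?thesis using c by simp
  qed
  then have A: "A = spectral_matrix B l"
    by (intro matrix_eq_on_onb[OF onb]) (auto simp: spectral_matrix_basis[OF onb])
  show ?thesis by (rule that[OF onb nonneg A])
qed

text \<open>Uniqueness of the square root: if \<open>S\<close> is positive semi-definite with square \<open>A\<close>, then
on an eigenvector \<open>b\<close> of \<open>A\<close> the vector \<open>S *v b - sqrt (f b) *\<^sub>R b\<close> would be an eigenvector of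
\<open>S\<close> with eigenvalue \<open>- sqrt (f b)\<close>, and so it must vanish if \<open>f b > 0\<close>; if \<open>f b = 0\<close>, then
\<open>(norm (S *v b))\<^sup>2 = b \<bullet> (S *v (S *v b)) = 0\<close>.\<close>

lemma psd_sqrt_spectral_matrix:
  fixes B :: "(real^'n) set"
  assumes onb: "onb B" and f: "\<And>b. b \<in> B \<Longrightarrow> f b \<ge> 0"
  shows "psd_sqrt (spectral_matrix B f) = spectral_matrix B (\<lambda>b. sqrt (f b))"
  unfolding psd_sqrt_def
proof (rule the_equality)
  have "(\<lambda>b. sqrt (f b) * sqrt (f b)) b = f b" if "b \<in> B" for b using f[OF that] by simp
  then have "spectral_matrix B (\<lambda>b. sqrt (f b) * sqrt (f b)) = spectral_matrix B f"
    by (intro matrix_eq_on_onb[OF onb]) (simp add: spectral_matrix_basis[OF onb])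
  then show "psd (spectral_matrix B (\<lambda>b. sqrt (f b))) \<and>
      spectral_matrix B (\<lambda>b. sqrt (f b)) ** spectral_matrix B (\<lambda>b. sqrt (f b)) = spectral_matrix B f"
    using f by (auto simp: spectral_matrix_mult[OF onb] intro!: psd_spectral_matrix)
next
  fix S assume S: "psd S \<and> S ** S = spectral_matrix B f"
  show "S = spectral_matrix B (\<lambda>b. sqrt (f b))"
  proof (rule matrix_eq_on_onb[OF onb])
    fix b assume b: "b \<in> B"
    have SS: "S *v (S *v b) = f b *\<^sub>R b"
      using S by (simp add: matrix_vector_mul_assoc spectral_matrix_basis[OF onb b])
    have sym: "transpose S = S" using S by (simp add: psd_def)
    let ?y = "S *v b - sqrt (f b) *\<^sub>R b"
    have "S *v ?y = - (sqrt (f b)) *\<^sub>R ?y"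
      using f[OF b]
      by (simp add: matrix_vector_mult_diff_distrib SS matrix_vector_mult_scaleR scaleR_diff_right)
    moreover have "?y \<bullet> (S *v ?y) \<ge> 0" using S by (simp add: psd_def)
    ultimately have le: "sqrt (f b) * (?y \<bullet> ?y) \<le> 0" by simp
    have "?y = 0"
    proof (cases "f b = 0")
      case True
      have "(S *v b) \<bullet> (S *v b) = 0"
        using SS True symmetric_inner[OF sym, of b "S *v b"] by simp
      then show ?thesis using True by simp
    next
      case False
      then have "sqrt (f b) > 0" using f[OF b] by simp
      then have "?y \<bullet> ?y \<le> 0" using le by (simp add: mult_le_0_iff)
      then show ?thesis by (metis inner_eq_zero_iff inner_ge_zero order_antisym)
    qed
    then show "S *v b = spectral_matrix B (\<lambda>b. sqrt (f b)) *v b"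
      by (simp add: spectral_matrix_basis[OF onb b])
  qed
qed

lemma is_pinv_unique:
  assumes X: "is_pinv A X" and Y: "is_pinv A Y"
  shows "X = Y"
proof -
  have AX: "A ** X = A ** Y"
  proof -
    have "A ** X = (A ** Y) ** (A ** X)" using Y by (simp add: is_pinv_def matrix_mul_assoc)
    also have "\<dots> = transpose (A ** Y) ** transpose (A ** X)" using X Y by (simp add: is_pinv_def)
    also have "\<dots> = transpose ((A ** X ** A) ** Y)"
      by (simp only: matrix_transpose_mul matrix_mul_assoc)
    also have "\<dots> = A ** Y" using X Y by (simp add: is_pinv_def)
    finally show ?thesis .
  qed
  have XA: "X ** A = Y ** A"
  proof -
    have "X ** A = (X ** A) ** (Y ** A)" using Y by (simp add: is_pinv_def matrix_mul_assoc[symmetric])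
    also have "\<dots> = transpose (X ** A) ** transpose (Y ** A)" using X Y by (simp add: is_pinv_def)
    also have "\<dots> = transpose (Y ** (A ** X ** A))"
      by (simp only: matrix_transpose_mul matrix_mul_assoc)
    also have "\<dots> = Y ** A" using X Y by (simp add: is_pinv_def)
    finally show ?thesis .
  qed
  have "X = (X ** A) ** X" using X by (simp add: is_pinv_def)
  also have "\<dots> = Y ** (A ** X)" by (simp add: XA matrix_mul_assoc)
  also have "\<dots> = Y" using Y by (simp add: AX is_pinv_def matrix_mul_assoc)
  finally show ?thesis .
qed

text \<open>The convention \<open>inverse 0 = 0\<close> is exactly what the Moore--Penrose inverse does to the
kernel.\<close>

lemma pinv_spectral_matrix:
  fixes B :: "(real^'n) set"
  assumes onb: "onb B"
  shows "pinv (spectral_matrix B f) = spectral_matrix B (\<lambda>b. inverse (f b))"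
proof -
  have *: "f b * inverse (f b) * f b = f b" "inverse (f b) * f b * inverse (f b) = inverse (f b)" for b
    by (cases "f b = 0"; simp)+
  have "is_pinv (spectral_matrix B f) (spectral_matrix B (\<lambda>b. inverse (f b)))"
    unfolding is_pinv_def by (simp add: spectral_matrix_mult[OF onb] * transpose_spectral_matrix)
  then show ?thesis unfolding pinv_def using is_pinv_unique by blast
qed

text \<open>Here \<open>S\<close> is the square root of \<open>\<Sigma>\<close> and \<open>S ** T\<close> is the orthogonal projection onto
the range of \<open>\<Sigma>\<close>. These five identities are all that is needed about square roots and
pseudo-inverses.\<close>

lemma psd_whitening:
  fixes \<Sigma> :: "real^'n^'n"
  assumes "psd \<Sigma>"
  defines "T \<equiv> psd_sqrt (pinv \<Sigma>)"
  obtains S where "transpose S = S" "S ** S = \<Sigma>" "S ** T = T ** S" "\<Sigma> ** (S ** T) = \<Sigma>" "transpose T = T"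
proof -
  obtain B l where B: "onb B" "\<And>b. b \<in> B \<Longrightarrow> l b \<ge> 0" "\<Sigma> = spectral_matrix B l"
    using psd_spectral_decomposition[OF assms(1)] by metis
  let ?S = "spectral_matrix B (\<lambda>b. sqrt (l b))"
  have T: "T = spectral_matrix B (\<lambda>b. sqrt (inverse (l b)))"
    using B(2) unfolding T_def B(3) pinv_spectral_matrix[OF B(1)]
    by (intro psd_sqrt_spectral_matrix[OF B(1)]) simp
  note [simp] = spectral_matrix_basis[OF B(1)] spectral_matrix_mult[OF B(1)] transpose_spectral_matrix
  show ?thesis
  proof (rule that[of ?S])
    show "?S ** ?S = \<Sigma>" using B(2) by (intro matrix_eq_on_onb[OF B(1)]) (simp add: B(3))
    show "?S ** T = T ** ?S" by (simp add: T mult.commute)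
    have "l b * (sqrt (l b) * sqrt (inverse (l b))) = l b" for b
      by (cases "l b = 0") (auto simp: real_sqrt_mult[symmetric])
    then have "(\<lambda>b. l b * (sqrt (l b) * sqrt (inverse (l b)))) = l" by blast
    then show "\<Sigma> ** (?S ** T) = \<Sigma>" by (simp only: T B(3) spectral_matrix_mult[OF B(1)])
  qed (simp_all add: T)
qed

section \<open>The isotropic Gaussian measure and its truncation\<close>

definition gauss_density :: "real \<Rightarrow> 'a::euclidean_space \<Rightarrow> real" where
  "gauss_density \<beta> x = (\<Prod>b\<in>Basis. normal_density 0 (1 / sqrt \<beta>) (x \<bullet> b))"

lemma gauss_density_nonneg [simp]: "0 \<le> gauss_density \<beta> x"
  by (simp add: gauss_density_def prod_nonneg)

lemma gauss_density_measurable [measurable]: "gauss_density \<beta> \<in> borel_measurable borel"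
  unfolding gauss_density_def by measurable

lemma gauss_density_eq:
  fixes x :: "'a::euclidean_space"
  assumes "\<beta> > 0"
  shows "gauss_density \<beta> x = (1 / sqrt (2 * pi / \<beta>)) ^ DIM('a) * exp (- \<beta> * (x \<bullet> x) / 2)"
proof -
  have *: "normal_density 0 (1 / sqrt \<beta>) y = 1 / sqrt (2 * pi / \<beta>) * exp (- \<beta> * (y * y) / 2)" for y
    using assms by (simp add: normal_density_def power_divide power2_eq_square)
  have "(\<Sum>b\<in>Basis. - \<beta> * ((x \<bullet> b) * (x \<bullet> b)) / 2) = - \<beta> * (x \<bullet> x) / 2"
    by (subst euclidean_inner) (simp add: sum_distrib_left sum_divide_distrib sum_negf)
  then show ?thesis
    unfolding gauss_density_def * prod.distrib by (simp add: exp_sum[symmetric])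
qed

lemma gauss_density_shift:
  fixes u h :: "'a::euclidean_space"
  assumes "\<beta> > 0"
  shows "gauss_density \<beta> (u + h) = gauss_density \<beta> h * exp (- \<beta> * (u \<bullet> u) / 2 - \<beta> * (u \<bullet> h))"
proof -
  have "- \<beta> * ((u + h) \<bullet> (u + h)) / 2 = - \<beta> * (h \<bullet> h) / 2 + (- \<beta> * (u \<bullet> u) / 2 - \<beta> * (u \<bullet> h))"
    by (simp add: inner_simps inner_commute field_simps)
  then show ?thesis by (simp only: gauss_density_eq[OF assms] exp_add mult.assoc)
qed

text \<open>The parameter \<open>\<beta>\<close> is the precision: the covariance is the identity divided by \<open>\<beta>\<close>.\<close>

definition gauss :: "real \<Rightarrow> ('a::euclidean_space) measure" where
  "gauss \<beta> = density lborel (\<lambda>x. ennreal (gauss_density \<beta> x))"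

lemma sets_gauss [simp, measurable_cong]: "sets (gauss \<beta>) = sets borel"
  by (simp add: gauss_def)

lemma space_gauss [simp]: "space (gauss \<beta>) = UNIV"
  by (simp add: gauss_def)

lemma nn_integral_gauss:
  assumes [measurable]: "f \<in> borel_measurable borel"
  shows "(\<integral>\<^sup>+x. f x \<partial>gauss \<beta>) = (\<integral>\<^sup>+x. ennreal (gauss_density \<beta> x) * f x \<partial>lborel)"
  unfolding gauss_def by (rule nn_integral_density) auto

lemma prob_space_gauss:
  assumes "\<beta> > 0"
  shows "prob_space (gauss \<beta> :: 'a::euclidean_space measure)"
proof
  have [simp]: "(\<integral>\<^sup>+x. ennreal (normal_density 0 (1 / sqrt \<beta>) x) \<partial>lborel) = 1"
    using assms by (subst nn_integral_eq_integral) auto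
  have "(\<integral>\<^sup>+x. 1 \<partial>(gauss \<beta> :: 'a measure)) = (\<integral>\<^sup>+(x::'a). (\<Prod>b\<in>Basis. ennreal (normal_density 0 (1 / sqrt \<beta>) (x \<bullet> b))) \<partial>lborel)"
    by (subst nn_integral_gauss) (simp_all add: gauss_density_def prod_ennreal)
  also have "\<dots> = 1"
    by (subst nn_integral_lborel_prod) auto
  finally show "emeasure (gauss \<beta> :: 'a measure) (space (gauss \<beta>)) = 1" by simp
qed

lemma gauss_second_moment:
  fixes b :: "'a::euclidean_space"
  assumes \<beta>: "\<beta> > 0" and b: "b \<in> Basis"
  shows "has_bochner_integral (gauss \<beta>) (\<lambda>x. (x \<bullet> b)\<^sup>2) (1 / \<beta>)"
proof (rule has_bochner_integral_nn_integral)
  let ?n = "normal_density 0 (1 / sqrt \<beta>)"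
  have [simp]: "(\<integral>\<^sup>+x. ennreal (?n x) \<partial>lborel) = 1"
    using assms by (subst nn_integral_eq_integral) auto
  have "has_bochner_integral lborel (\<lambda>x. ?n x * (x - 0) ^ (2 * 1)) (fact (2 * 1) / ((2 / (1 / sqrt \<beta>)\<^sup>2) ^ 1 * fact 1))"
    using \<beta> by (intro normal_moment_even) auto
  then have "has_bochner_integral lborel (\<lambda>x. ?n x * x\<^sup>2) (1 / \<beta>)"
    using \<beta> by (simp add: power_divide)
  then have [simp]: "(\<integral>\<^sup>+x. ennreal (?n x * x\<^sup>2) \<partial>lborel) = ennreal (1 / \<beta>)"
    by (subst nn_integral_eq_integral) (auto simp: has_bochner_integral_iff)
  let ?f = "\<lambda>c x. if c = b then ennreal (?n x * x\<^sup>2) else ennreal (?n x)"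
  have "ennreal (gauss_density \<beta> x) * ennreal ((x \<bullet> b)\<^sup>2) = (\<Prod>c\<in>Basis. ?f c (x \<bullet> c))" for x
  proof -
    have "(\<Prod>c\<in>Basis. ?f c (x \<bullet> c)) = ?f b (x \<bullet> b) * (\<Prod>c\<in>Basis - {b}. ?f c (x \<bullet> c))"
      using b by (intro prod.remove) auto
    also have "(\<Prod>c\<in>Basis - {b}. ?f c (x \<bullet> c)) = (\<Prod>c\<in>Basis - {b}. ennreal (?n (x \<bullet> c)))"
      by (intro prod.cong) auto
    also have "\<dots> = ennreal (\<Prod>c\<in>Basis - {b}. ?n (x \<bullet> c))" by (simp add: prod_ennreal)
    also have "?f b (x \<bullet> b) * \<dots> = ennreal (?n (x \<bullet> b) * (\<Prod>c\<in>Basis - {b}. ?n (x \<bullet> c)) * (x \<bullet> b)\<^sup>2)"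
      by (simp add: ennreal_mult''[symmetric] prod_nonneg ac_simps)
    also have "?n (x \<bullet> b) * (\<Prod>c\<in>Basis - {b}. ?n (x \<bullet> c)) = gauss_density \<beta> x"
      unfolding gauss_density_def using b by (intro prod.remove[symmetric]) auto
    finally show ?thesis by (simp add: ennreal_mult'')
  qed
  then have "(\<integral>\<^sup>+x. ennreal ((x \<bullet> b)\<^sup>2) \<partial>gauss \<beta>) = (\<integral>\<^sup>+x. (\<Prod>c\<in>Basis. ?f c (x \<bullet> c)) \<partial>lborel)"
    by (subst nn_integral_gauss) auto
  also have "\<dots> = (\<Prod>c\<in>Basis. \<integral>\<^sup>+x. ?f c x \<partial>lborel)"
    by (rule nn_integral_lborel_prod) auto
  also have "\<dots> = (\<Prod>c\<in>Basis. if c = b then ennreal (1 / \<beta>) else 1)"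
    by (intro prod.cong) auto
  also have "\<dots> = ennreal (1 / \<beta>)" using b by simp
  finally show "(\<integral>\<^sup>+x. ennreal ((x \<bullet> b)\<^sup>2) \<partial>gauss \<beta>) = ennreal (1 / \<beta>)" .
qed (use \<beta> in auto)

text \<open>Flipping one coordinate makes different coordinates uncorrelated, and flipping all of
them makes symmetric truncations centred.\<close>

lemma gauss_sign_flip:
  fixes s :: "'a::euclidean_space \<Rightarrow> real" and f :: "'a \<Rightarrow> 'b::{banach, second_countable_topology}"
  assumes s: "\<And>b. b \<in> Basis \<Longrightarrow> s b \<in> {1, -1}" and [measurable]: "f \<in> borel_measurable borel"
  defines "T x \<equiv> (\<Sum>b\<in>Basis. (s b * (x \<bullet> b)) *\<^sub>R b)"
  shows "(\<integral>x. f (T x) \<partial>gauss \<beta>) = (\<integral>x. f x \<partial>gauss \<beta>)"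
proof -
  have "lborel = density (distr lborel borel (\<lambda>x. 0 + T x)) (\<lambda>_. (\<Prod>j\<in>Basis. \<bar>s j\<bar>))"
    unfolding T_def using s by (intro lborel_affine_euclidean) force
  moreover have "(\<Prod>j\<in>(Basis::'a set). \<bar>s j\<bar>) = 1" using s by (intro prod.neutral) force
  ultimately have lb: "lborel = distr lborel borel T" by (simp add: density_1)
  have [measurable]: "T \<in> borel_measurable borel" unfolding T_def by measurable
  have "T x \<bullet> b = s b * (x \<bullet> b)" if "b \<in> Basis" for x b
    using that by (simp add: T_def inner_sum_left inner_Basis if_distrib[of "\<lambda>x. _ * x"] cong: if_cong)
  then have G: "gauss_density \<beta> (T x) = gauss_density \<beta> x" for x
    unfolding gauss_density_def using s by (intro prod.cong) (force simp: normal_density_def)+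
  have "(\<integral>x. f x \<partial>gauss \<beta>) = (\<integral>x. gauss_density \<beta> x *\<^sub>R f x \<partial>lborel)"
    unfolding gauss_def by (intro integral_density) auto
  also have "\<dots> = (\<integral>x. gauss_density \<beta> x *\<^sub>R f x \<partial>distr lborel borel T)"
    using lb by simp
  also have "\<dots> = (\<integral>x. gauss_density \<beta> x *\<^sub>R f (T x) \<partial>lborel)"
    by (subst integral_distr) (auto simp: G)
  also have "\<dots> = (\<integral>x. f (T x) \<partial>gauss \<beta>)"
    unfolding gauss_def by (intro integral_density[symmetric]) auto
  finally show ?thesis by simp
qed

lemma gauss_uminus:
  fixes f :: "'a::euclidean_space \<Rightarrow> 'b::{banach, second_countable_topology}"
  assumes "f \<in> borel_measurable borel"
  shows "(\<integral>x. f (- x) \<partial>gauss \<beta>) = (\<integral>x. f x \<partial>gauss \<beta>)"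
proof -
  have "(\<Sum>b\<in>Basis. (- 1 * (x \<bullet> b)) *\<^sub>R b) = - x" for x :: 'a
    by (simp add: sum_negf euclidean_representation)
  then show ?thesis using gauss_sign_flip[of "\<lambda>_. - 1" f \<beta>] assms by simp
qed

lemma gauss_norm_square_integrable:
  assumes "\<beta> > 0"
  shows "integrable (gauss \<beta>) (\<lambda>x::'a::euclidean_space. (norm x)\<^sup>2)"
proof -
  have "(norm x)\<^sup>2 = (\<Sum>b\<in>Basis. (x \<bullet> b)\<^sup>2)" for x :: 'a
    unfolding power2_norm_eq_inner by (subst euclidean_inner) (simp add: power2_eq_square)
  moreover have "integrable (gauss \<beta>) (\<lambda>x::'a. \<Sum>b\<in>Basis. (x \<bullet> b)\<^sup>2)"
    using gauss_second_moment[OF assms] by (intro Bochner_Integration.integrable_sum) (auto simp: has_bochner_integral_iff)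
  ultimately show ?thesis by simp
qed

lemma gauss_covariance:
  fixes b c :: "'a::euclidean_space"
  assumes \<beta>: "\<beta> > 0" and b: "b \<in> Basis" "c \<in> Basis"
  shows "integrable (gauss \<beta>) (\<lambda>x. (x \<bullet> b) * (x \<bullet> c))"
    and "(\<integral>x. (x \<bullet> b) * (x \<bullet> c) \<partial>gauss \<beta>) = (if b = c then 1 / \<beta> else 0)"
proof -
  show "integrable (gauss \<beta>) (\<lambda>x. (x \<bullet> b) * (x \<bullet> c))"
  proof (rule Bochner_Integration.integrable_bound[OF gauss_norm_square_integrable[OF \<beta>]])
    show "AE x in gauss \<beta>. norm ((x \<bullet> b) * (x \<bullet> c)) \<le> norm ((norm x)\<^sup>2)"
      using b by (auto simp: abs_mult power2_eq_square intro!: mult_mono Basis_le_norm)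
  qed simp
  show "(\<integral>x. (x \<bullet> b) * (x \<bullet> c) \<partial>gauss \<beta>) = (if b = c then 1 / \<beta> else 0)"
  proof (cases "b = c")
    case True
    then show ?thesis using gauss_second_moment[OF \<beta> b(1)]
      by (simp add: has_bochner_integral_iff power2_eq_square)
  next
    case False
    let ?s = "\<lambda>j. if j = b then - 1 else (1::real)"
    have *: "(\<Sum>j\<in>Basis. (?s j * (x \<bullet> j)) *\<^sub>R j) \<bullet> d = ?s d * (x \<bullet> d)" if "d \<in> Basis" for x d :: 'a
      using that by (simp add: inner_sum_left inner_Basis if_distrib[of "\<lambda>x. _ * x"] cong: if_cong)
    have "(\<integral>x. (x \<bullet> b) * (x \<bullet> c) \<partial>gauss \<beta>) = - (\<integral>x. (x \<bullet> b) * (x \<bullet> c) \<partial>gauss \<beta>)"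
      using gauss_sign_flip[of ?s "\<lambda>x. (x \<bullet> b) * (x \<bullet> c)" \<beta>] *[OF b(1)] *[OF b(2)] False
      by simp
    then show ?thesis using False by simp
  qed
qed

lemma gauss_linear_image:
  fixes S :: "'a::euclidean_space \<Rightarrow> 'b::real_inner"
  assumes \<beta>: "\<beta> > 0" and S: "linear S"
  shows "has_bochner_integral (gauss \<beta>) (\<lambda>x. (norm (S x))\<^sup>2) ((\<Sum>b\<in>Basis. (norm (S b))\<^sup>2) / \<beta>)"
proof -
  have *: "(norm (S x))\<^sup>2 = (\<Sum>b\<in>Basis. \<Sum>c\<in>Basis. (S b \<bullet> S c) * ((x \<bullet> b) * (x \<bullet> c)))" for x
  proof -
    have "S x = (\<Sum>b\<in>Basis. (x \<bullet> b) *\<^sub>R S b)"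
      by (subst euclidean_representation[of x, symmetric]) (simp only: linear_sum[OF S] linear_scale[OF S])
    then show ?thesis
      by (simp add: power2_norm_eq_inner inner_sum_left inner_sum_right sum_distrib_left inner_commute mult_ac)
  qed
  have "has_bochner_integral (gauss \<beta>) (\<lambda>x. (x \<bullet> b) * (x \<bullet> c)) (if b = c then 1 / \<beta> else 0)"
    if "b \<in> Basis" "c \<in> Basis" for b c :: 'a
    using gauss_covariance[OF \<beta> that] by (simp add: has_bochner_integral_iff)
  then have "has_bochner_integral (gauss \<beta>) (\<lambda>x. (norm (S x))\<^sup>2)
      (\<Sum>b\<in>Basis. \<Sum>c\<in>Basis. (S b \<bullet> S c) * (if b = c then 1 / \<beta> else 0))"
    unfolding * by (intro has_bochner_integral_sum has_bochner_integral_mult_right) auto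
  then show ?thesis
    by (simp add: power2_norm_eq_inner sum_divide_distrib if_distrib[of "\<lambda>x. _ * x"] cong: if_cong)
qed

text \<open>Cameron--Martin formula. It takes the place of the computation of the Kullback--Leibler
divergence between a Gaussian measure and its translate.\<close>

lemma gauss_shift:
  fixes f :: "'a::euclidean_space \<Rightarrow> ennreal"
  assumes \<beta>: "\<beta> > 0" and [measurable]: "f \<in> borel_measurable borel"
  shows "(\<integral>\<^sup>+h. f (u + h) * ennreal (exp (- \<beta> * (u \<bullet> u) / 2 - \<beta> * (u \<bullet> h))) \<partial>gauss \<beta>) = (\<integral>\<^sup>+y. f y \<partial>gauss \<beta>)"
proof -
  have "(\<integral>\<^sup>+y. f y \<partial>gauss \<beta>) = (\<integral>\<^sup>+y. ennreal (gauss_density \<beta> y) * f y \<partial>distr lborel borel ((+) u))"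
    by (simp add: nn_integral_gauss lborel_distr_plus)
  also have "\<dots> = (\<integral>\<^sup>+h. ennreal (gauss_density \<beta> (u + h)) * f (u + h) \<partial>lborel)"
    by (subst nn_integral_distr) auto
  also have "\<dots> = (\<integral>\<^sup>+h. ennreal (gauss_density \<beta> h) * (f (u + h) * ennreal (exp (- \<beta> * (u \<bullet> u) / 2 - \<beta> * (u \<bullet> h)))) \<partial>lborel)"
    by (intro nn_integral_cong) (simp only: gauss_density_shift[OF \<beta>] ennreal_mult'' exp_ge_zero mult_ac)
  also have "\<dots> = (\<integral>\<^sup>+h. f (u + h) * ennreal (exp (- \<beta> * (u \<bullet> u) / 2 - \<beta> * (u \<bullet> h))) \<partial>gauss \<beta>)"
    by (subst nn_integral_gauss) auto
  finally show ?thesis by simp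
qed

text \<open>The posterior, up to translation: the Gaussian measure conditioned on the event that
\<open>S h\<close> is at most \<open>sqrt 2\<close> times its root mean square. By Markov's inequality this event has
probability at least one half, so conditioning costs only a factor 2 in the last property; as the
event is symmetric, the conditioned measure is still centred. Truncation is what keeps the rank
one matrices built from \<open>S (u + h)\<close> bounded in norm, which an exponential moment of
Bernstein type needs.\<close>

lemma truncated_gauss:
  fixes S :: "'a::euclidean_space \<Rightarrow> 'b::euclidean_space"
  assumes \<beta>: "\<beta> > 0" and S: "linear S"
  obtains \<rho> :: "'a measure" where "prob_space \<rho>" "sets \<rho> = sets borel"
    "AE h in \<rho>. (norm (S h))\<^sup>2 \<le> 2 * (\<Sum>b\<in>Basis. (norm (S b))\<^sup>2) / \<beta>"
    "integrable \<rho> (\<lambda>h. (norm h)\<^sup>2)"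
    "(\<integral>h. h \<partial>\<rho>) = 0"
    "\<And>f u. f \<in> borel_measurable borel \<Longrightarrow>
      (\<integral>\<^sup>+h. f (u + h) * ennreal (exp (- \<beta> * (u \<bullet> u) / 2 - \<beta> * (u \<bullet> h))) \<partial>\<rho>) \<le> 2 * (\<integral>\<^sup>+y. f y \<partial>gauss \<beta>)"
proof -
  interpret g: prob_space "gauss \<beta> :: 'a measure" using \<beta> by (rule prob_space_gauss)
  define F where "F = (\<Sum>b\<in>Basis. (norm (S b))\<^sup>2)"
  have F0: "F \<ge> 0" by (simp add: F_def sum_nonneg)
  define E where "E = {h. (norm (S h))\<^sup>2 \<le> 2 * F / \<beta>}"
  have [measurable]: "S \<in> borel_measurable borel"
    by (intro borel_measurable_continuous_onI linear_continuous_on) (simp add: S linear_conv_bounded_linear[symmetric])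
  have E[measurable]: "E \<in> sets borel" unfolding E_def by measurable
  have half: "measure (gauss \<beta>) E \<ge> 1 / 2"
  proof (cases "F = 0")
    case True
    then have "S b = 0" if "b \<in> Basis" for b
      using that by (auto simp: F_def sum_nonneg_eq_0_iff)
    then have "S h = 0" for h
      using linear_eq_on[of S "\<lambda>_. 0" h Basis] S by (auto intro: linear_zero)
    then have "E = UNIV" using True by (simp add: E_def)
    then show ?thesis using g.prob_space by simp
  next
    case False
    then have pos: "2 * F / \<beta> > 0" using F0 \<beta> by simp
    have hb: "has_bochner_integral (gauss \<beta>) (\<lambda>x. (norm (S x))\<^sup>2) (F / \<beta>)"
      unfolding F_def by (rule gauss_linear_image[OF \<beta> S])
    then have "measure (gauss \<beta>) {x\<in>space (gauss \<beta>). (norm (S x))\<^sup>2 \<ge> 2 * F / \<beta>} \<le> (\<integral>x. (norm (S x))\<^sup>2 \<partial>gauss \<beta>) / (2 * F / \<beta>)"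
      by (intro integral_Markov_inequality_measure[where A = "{}"] pos) (auto simp: has_bochner_integral_iff)
    also have "\<dots> = 1 / 2" using hb False \<beta> by (simp add: has_bochner_integral_iff)
    finally have "measure (gauss \<beta>) {x. (norm (S x))\<^sup>2 \<ge> 2 * F / \<beta>} \<le> 1 / 2" by simp
    moreover have "measure (gauss \<beta>) (UNIV - E) \<le> measure (gauss \<beta>) {x. (norm (S x))\<^sup>2 \<ge> 2 * F / \<beta>}"
      by (intro g.finite_measure_mono) (auto simp: E_def)
    moreover have "measure (gauss \<beta>) (UNIV - E) = 1 - measure (gauss \<beta>) E"
      using g.prob_compl[of E] by simp
    ultimately show ?thesis by linarith
  qed
  define m where "m = measure (gauss \<beta>) E"
  have m: "m \<ge> 1/2" using half by (simp add: m_def)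
  define w where "w h = indicator E h / m" for h :: 'a
  have w0: "w h \<ge> 0" for h using m by (simp add: w_def)
  have w2: "w h \<le> 2" for h using m by (simp add: w_def indicator_def field_simps)
  have [measurable]: "w \<in> borel_measurable borel" unfolding w_def by measurable
  define \<rho> where "\<rho> = density (gauss \<beta>) (\<lambda>h. ennreal (w h))"
  have sets: "sets \<rho> = sets borel" by (simp add: \<rho>_def)
  show ?thesis
  proof (rule that[of \<rho>])
    show "prob_space \<rho>"
    proof
      have "emeasure \<rho> (space \<rho>) = (\<integral>\<^sup>+h. ennreal (1 / m) * indicator E h \<partial>gauss \<beta>)"
        unfolding \<rho>_def
        by (subst emeasure_density) (auto intro!: nn_integral_cong simp: w_def split: split_indicator)
      also have "\<dots> = ennreal (1 / m) * ennreal m"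
        by (subst nn_integral_cmult_indicator) (auto simp: g.emeasure_eq_measure m_def)
      also have "\<dots> = 1" using m by (simp add: ennreal_mult''[symmetric])
      finally show "emeasure \<rho> (space \<rho>) = 1" .
    qed
    show "AE h in \<rho>. (norm (S h))\<^sup>2 \<le> 2 * (\<Sum>b\<in>Basis. (norm (S b))\<^sup>2) / \<beta>"
      unfolding \<rho>_def using m
      by (subst AE_density) (auto intro!: AE_I2 simp: w_def E_def F_def split: split_indicator_asm)
    show "integrable \<rho> (\<lambda>h. (norm h)\<^sup>2)"
      unfolding \<rho>_def
    proof (subst integrable_density)
      show "integrable (gauss \<beta>) (\<lambda>h::'a. w h *\<^sub>R (norm h)\<^sup>2)"
        using integrable_mult_right[OF gauss_norm_square_integrable[OF \<beta>, where 'a='a], of 2]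
        by (rule Bochner_Integration.integrable_bound) (use w0 w2 in \<open>auto intro!: mult_right_mono\<close>)
    qed (use w0 in auto)
    show "(\<integral>h. h \<partial>\<rho>) = 0"
    proof -
      have "w (- h) = w h" for h
        using linear_neg[OF S] by (simp add: w_def E_def indicator_def)
      then have "(\<integral>h. w h *\<^sub>R h \<partial>gauss \<beta>) = - (\<integral>h. w h *\<^sub>R h \<partial>gauss \<beta>)"
        using gauss_uminus[of "\<lambda>h. w h *\<^sub>R h" \<beta>] by simp
      then have "(\<integral>h. w h *\<^sub>R h \<partial>gauss \<beta>) = 0" by (metis add.right_inverse add_cancel_right_left scaleR_2 scaleR_eq_0_iff zero_neq_numeral)
      then show ?thesis unfolding \<rho>_def using w0 by (subst integral_density) auto
    qed
    show "(\<integral>\<^sup>+h. f (u + h) * ennreal (exp (- \<beta> * (u \<bullet> u) / 2 - \<beta> * (u \<bullet> h))) \<partial>\<rho>) \<le> 2 * (\<integral>\<^sup>+y. f y \<partial>gauss \<beta>)"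
      if [measurable]: "f \<in> borel_measurable borel" for f u
    proof -
      let ?e = "\<lambda>h. f (u + h) * ennreal (exp (- \<beta> * (u \<bullet> u) / 2 - \<beta> * (u \<bullet> h)))"
      have "(\<integral>\<^sup>+h. ?e h \<partial>\<rho>) = (\<integral>\<^sup>+h. ennreal (w h) * ?e h \<partial>gauss \<beta>)"
        unfolding \<rho>_def by (subst nn_integral_density) auto
      also have "\<dots> \<le> (\<integral>\<^sup>+h. 2 * ?e h \<partial>gauss \<beta>)"
      proof (intro nn_integral_mono mult_right_mono)
        show "ennreal (w h) \<le> 2" for h using ennreal_leI[OF w2[of h]] by simp
      qed auto
      also have "\<dots> = 2 * (\<integral>\<^sup>+h. ?e h \<partial>gauss \<beta>)" by (subst nn_integral_cmult) auto
      finally show ?thesis unfolding gauss_shift[OF \<beta> that] .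
    qed
  qed (rule sets)
qed

section \<open>Rank one matrices, trace and operator norm\<close>

definition outer :: "real^'n \<Rightarrow> real^'n \<Rightarrow> real^'n^'n" where
  "outer v w = (\<chi> i j. v $ i * w $ j)"

lemma bounded_bilinear_outer: "bounded_bilinear (outer :: real^'n \<Rightarrow> _)"
  unfolding bilinear_conv_bounded_bilinear[symmetric] bilinear_def linear_iff
  by (simp add: outer_def vec_eq_iff algebra_simps)

lemma bounded_bilinear_matrix_mult: "bounded_bilinear ((**) :: real^'n^'m \<Rightarrow> real^'k^'n \<Rightarrow> _)"
  unfolding bilinear_conv_bounded_bilinear[symmetric] bilinear_def linear_iff
  by (auto simp: matrix_matrix_mult_def vec_eq_iff algebra_simps sum.distrib sum_distrib_left)

lemma bounded_bilinear_matrix_vector_mult: "bounded_bilinear ((*v) :: real^'n^'m \<Rightarrow> _)"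
  unfolding bilinear_conv_bounded_bilinear[symmetric] bilinear_def linear_iff
  by (auto simp: matrix_vector_mult_def vec_eq_iff algebra_simps sum.distrib sum_distrib_left)

lemma bounded_linear_quadratic: "bounded_linear (\<lambda>A :: real^'n^'n. x \<bullet> (A *v x))"
  by (intro bounded_linear_inner_right_comp bounded_bilinear.bounded_linear_left bounded_bilinear_matrix_vector_mult)

lemma bounded_linear_sandwich: "bounded_linear (\<lambda>A :: real^'n^'n. T ** A ** T)"
  by (intro bounded_linear_compose[OF bounded_bilinear.bounded_linear_left[OF bounded_bilinear_matrix_mult]]
        bounded_bilinear.bounded_linear_right bounded_bilinear_matrix_mult)

lemma bounded_linear_trace: "bounded_linear (trace :: real^'n^'n \<Rightarrow> real)"
  unfolding linear_conv_bounded_linear[symmetric] linear_iff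
  by (auto simp: trace_def sum.distrib sum_distrib_left)

lemma bounded_linear_transpose: "bounded_linear (transpose :: real^'n^'m \<Rightarrow> _)"
  unfolding linear_conv_bounded_linear[symmetric] linear_iff
  by (auto simp: transpose_def vec_eq_iff)

lemma outer_mult_vec: "outer v w *v x = (w \<bullet> x) *\<^sub>R v"
  by (simp add: outer_def matrix_vector_mult_def vec_eq_iff inner_vec_def sum_distrib_left mult_ac)

lemma trace_outer: "trace (outer v w) = v \<bullet> w"
  by (simp add: outer_def trace_def inner_vec_def)

lemma trace_outer_mult: "trace (outer v w ** A) = w \<bullet> (A *v v)"
  unfolding trace_def outer_def matrix_matrix_mult_def matrix_vector_mult_def inner_vec_def
  by (simp add: sum_distrib_left mult_ac) (rule sum.swap)

lemma transpose_outer: "transpose (outer v w) = outer w v"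
  by (simp add: outer_def transpose_def vec_eq_iff mult_ac)

lemma psd_outer: "psd (outer v v)"
  by (simp add: psd_def transpose_outer outer_mult_vec inner_commute)

lemma norm_matrix_vector_le: "norm (A *v x) \<le> opnorm A * norm x" for A :: "real^'n^'m"
  by (rule onorm) (rule matrix_vector_mul_bounded_linear)

lemma opnorm_nonneg: "opnorm A \<ge> 0" for A :: "real^'n^'m"
  by (rule onorm_pos_le) (rule matrix_vector_mul_bounded_linear)

lemma opnorm_eq_0: "opnorm A = 0 \<longleftrightarrow> A = 0" for A :: "real^'n^'m"
  by (subst onorm_eq_0) (auto simp: matrix_eq matrix_vector_mul_bounded_linear)

lemma opnorm_outer_le: "opnorm (outer v v) \<le> v \<bullet> v"
proof (rule onorm_le)
  fix x
  have "norm (outer v v *v x) = \<bar>v \<bullet> x\<bar> * norm v" by (simp add: outer_mult_vec)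
  also have "\<dots> \<le> (norm v * norm x) * norm v" by (intro mult_right_mono Cauchy_Schwarz_ineq2) auto
  finally show "norm (outer v v *v x) \<le> v \<bullet> v * norm x" by (simp add: dot_square_norm power2_eq_square mult_ac)
qed

text \<open>Polarisation, applied to \<open>x\<close> and \<open>H *v x\<close> after rescaling both to the same
length.\<close>

lemma opnorm_symmetric_le:
  fixes H :: "real^'n^'n"
  assumes sym: "transpose H = H" and c: "c \<ge> 0" and q: "\<And>x. \<bar>x \<bullet> (H *v x)\<bar> \<le> c * (x \<bullet> x)"
  shows "opnorm H \<le> c"
proof (rule onorm_le)
  fix x
  define y where "y = H *v x"
  show "norm (H *v x) \<le> c * norm x"
  proof (cases "y = 0 \<or> x = 0")
    case True
    then show ?thesis using c by (auto simp: y_def)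
  next
    case False
    then have pos: "norm y > 0" "norm x > 0" by auto
    define a b where "a = norm y *\<^sub>R x" and "b = norm x *\<^sub>R y"
    have "4 * (b \<bullet> (H *v a)) = (a + b) \<bullet> (H *v (a + b)) - (a - b) \<bullet> (H *v (a - b))"
      using symmetric_inner[OF sym, of a b]
      by (simp add: matrix_vector_right_distrib matrix_vector_mult_diff_distrib inner_simps inner_commute)
    also have "\<dots> \<le> c * ((a + b) \<bullet> (a + b)) + c * ((a - b) \<bullet> (a - b))"
      using q[of "a + b"] q[of "a - b"] by linarith
    also have "\<dots> = 2 * c * (a \<bullet> a + b \<bullet> b)"
      by (simp add: inner_simps inner_commute algebra_simps)
    also have "\<dots> = 4 * (c * norm x * (norm y * norm x * norm y))"
      by (simp add: a_def b_def dot_square_norm power2_eq_square algebra_simps)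
    finally have "b \<bullet> (H *v a) \<le> c * norm x * (norm y * norm x * norm y)" by simp
    moreover have "b \<bullet> (H *v a) = norm y * (norm y * norm x * norm y)"
      by (simp add: a_def b_def matrix_vector_mult_scaleR y_def[symmetric] dot_square_norm power2_eq_square)
    ultimately show ?thesis using pos by (simp add: y_def[symmetric])
  qed
qed

lemma trace_psd_nonneg:
  assumes "psd A"
  shows "trace A \<ge> 0"
proof -
  have "A $ i $ i = axis i 1 \<bullet> (A *v axis i 1)" for i
    by (simp add: inner_axis' matrix_vector_mult_basis column_def)
  then show ?thesis using assms unfolding trace_def psd_def by (intro sum_nonneg) simp
qed

lemma closed_opnorm_le: "closed {A :: real^'n^'m. opnorm A \<le> c}"
proof -
  have "{A :: real^'n^'m. opnorm A \<le> c} = {A. \<forall>x. norm (A *v x) \<le> c * norm x}"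
    using onorm_le norm_matrix_vector_le by (auto intro: order_trans[OF norm_matrix_vector_le mult_right_mono])
  moreover have "closed {A :: real^'n^'m. norm (A *v x) \<le> c * norm x}" for x
    by (intro closed_Collect_le continuous_intros linear_continuous_on
        bounded_bilinear.bounded_linear_left[OF bounded_bilinear_matrix_vector_mult])
  ultimately show ?thesis by (simp add: closed_Collect_all)
qed

lemma sum_Basis_vec:
  fixes f :: "real^'n \<Rightarrow> real"
  shows "(\<Sum>b\<in>Basis. f b) = (\<Sum>i\<in>UNIV. f (axis i (1::real)))"
proof -
  have "(Basis :: (real^'n) set) = range (\<lambda>i. axis i 1)" by (auto simp: Basis_vec_def)
  moreover have "inj (\<lambda>i. axis i 1 :: real^'n)" by (auto simp: inj_on_def axis_eq_axis)
  ultimately show ?thesis using sum.reindex[of "\<lambda>i. axis i 1 :: real^'n" UNIV f] by (simp only: o_def)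
qed

lemma symmetric_frobenius:
  fixes S :: "real^'n^'n"
  assumes sym: "transpose S = S"
  shows "(\<Sum>b\<in>Basis. (norm (S *v b))\<^sup>2) = trace (S ** S)"
    and "(norm (S *v x))\<^sup>2 \<le> trace (S ** S) * (norm x)\<^sup>2"
proof -
  have "(S ** S) $ i $ i = (norm (S *v axis i 1))\<^sup>2" for i
  proof -
    have "(S ** S) $ i $ i = axis i 1 \<bullet> (S *v (S *v axis i 1))"
      unfolding matrix_vector_mul_assoc by (simp add: inner_axis' matrix_vector_mult_basis column_def)
    then show ?thesis by (simp add: symmetric_inner[OF sym] dot_square_norm)
  qed
  then have tr: "trace (S ** S) = (\<Sum>i\<in>UNIV. (norm (S *v axis i 1))\<^sup>2)" by (simp add: trace_def)
  then show "(\<Sum>b\<in>Basis. (norm (S *v b))\<^sup>2) = trace (S ** S)" by (simp add: sum_Basis_vec)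
  have "(S *v x) $ i = (S *v axis i 1) \<bullet> x" for i
    using symmetric_inner[OF sym, of "axis i 1" x] by (simp add: inner_axis')
  moreover have "(norm (S *v x))\<^sup>2 = (\<Sum>i\<in>UNIV. ((S *v x) $ i)\<^sup>2)"
    unfolding power2_norm_eq_inner by (simp add: inner_vec_def power2_eq_square)
  ultimately have "(norm (S *v x))\<^sup>2 = (\<Sum>i\<in>UNIV. ((S *v axis i 1) \<bullet> x)\<^sup>2)" by simp
  also have "\<dots> \<le> (\<Sum>i\<in>UNIV. (norm (S *v axis i 1))\<^sup>2 * (norm x)\<^sup>2)"
    by (intro sum_mono) (metis Cauchy_Schwarz_ineq power2_norm_eq_inner)
  finally show "(norm (S *v x))\<^sup>2 \<le> trace (S ** S) * (norm x)\<^sup>2" by (simp add: tr sum_distrib_right)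
qed

lemma psd_kernel:
  assumes M: "psd M" and x: "x \<bullet> (M *v x) = 0"
  shows "M *v x = 0"
proof -
  let ?w = "M *v x"
  have "- (?w \<bullet> ?w) = 0"
  proof (rule quadratic_bound_imp_zero)
    fix t :: real
    have "0 \<le> (x + t *\<^sub>R ?w) \<bullet> (M *v (x + t *\<^sub>R ?w))" using M by (simp add: psd_def)
    also have "\<dots> = 2 * t * (?w \<bullet> ?w) + t\<^sup>2 * (?w \<bullet> (M *v ?w))"
      using M x symmetric_inner[of M x ?w]
      by (simp add: psd_def matrix_vector_right_distrib matrix_vector_mult_scaleR inner_simps power2_eq_square algebra_simps)
    finally show "2 * t * - (?w \<bullet> ?w) \<le> t\<^sup>2 * (?w \<bullet> (M *v ?w))" by simp
  qed
  then show ?thesis by simp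
qed

section \<open>Exponential moments and the change of measure\<close>

text \<open>The hypothesis of the theorem, with \<open>W\<close> the centred sum of the whitened matrices.\<close>

definition trace_bernstein :: "'a measure \<Rightarrow> ('a \<Rightarrow> real^'n^'n) \<Rightarrow> real \<Rightarrow> nat \<Rightarrow> bool" where
  "trace_bernstein P W K n \<longleftrightarrow> (\<forall>A \<tau>. psd A \<longrightarrow> (A \<noteq> 0 \<longrightarrow> \<tau> < 1 / (2 * opnorm A * K)) \<longrightarrow>
     integrable P (\<lambda>\<omega>. exp (\<tau> * trace (A ** W \<omega>))) \<and>
     (\<integral>\<omega>. exp (\<tau> * trace (A ** W \<omega>)) \<partial>P)
       \<le> exp (2 * opnorm A * K * \<tau>\<^sup>2 / (1 - 2 * opnorm A * K * \<tau>) * real n * trace A))"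

text \<open>For negative \<open>\<tau>\<close> the denominator only grows, so one bound in \<open>\<bar>\<tau>\<bar>\<close> serves both tails.
It is an integral of a nonnegative function so that it can be integrated over \<open>A\<close> without
any further integrability condition.\<close>

lemma trace_bernstein_uniform:
  assumes W: "trace_bernstein P W K n" and K: "K > 0" and A: "psd A" "opnorm A \<le> c" "trace A \<le> c"
    and \<tau>: "2 * c * K * \<bar>\<tau>\<bar> < 1"
  shows "(\<integral>\<^sup>+\<omega>. ennreal (exp (\<tau> * trace (A ** W \<omega>))) \<partial>P)
    \<le> ennreal (exp (2 * c\<^sup>2 * K * \<tau>\<^sup>2 * real n / (1 - 2 * c * K * \<bar>\<tau>\<bar>)))"
proof -
  let ?a = "opnorm A"
  have a0: "?a \<ge> 0" by (rule opnorm_nonneg)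
  have c0: "c \<ge> 0" using a0 A(2) by linarith
  have "2 * ?a * K * \<tau> \<le> 2 * ?a * K * \<bar>\<tau>\<bar>" using a0 K by (intro mult_left_mono) auto
  also have "\<dots> \<le> 2 * c * K * \<bar>\<tau>\<bar>" using A(2) K by (intro mult_right_mono mult_left_mono) auto
  finally have le: "2 * ?a * K * \<tau> \<le> 2 * c * K * \<bar>\<tau>\<bar>" .
  have "\<tau> < 1 / (2 * ?a * K)" if "A \<noteq> 0"
  proof -
    have "?a > 0" using that a0 opnorm_eq_0[of A] by linarith
    then have "2 * ?a * K > 0" using K by simp
    moreover have "\<tau> * (2 * ?a * K) < 1" using le \<tau> by (simp only: mult.commute[of \<tau>])
    ultimately show ?thesis by (simp only: pos_less_divide_eq)
  qed
  then have int: "integrable P (\<lambda>\<omega>. exp (\<tau> * trace (A ** W \<omega>)))"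
    and bnd: "(\<integral>\<omega>. exp (\<tau> * trace (A ** W \<omega>)) \<partial>P)
       \<le> exp (2 * ?a * K * \<tau>\<^sup>2 / (1 - 2 * ?a * K * \<tau>) * real n * trace A)"
    using W A(1) unfolding trace_bernstein_def by blast+
  have "2 * ?a * K * \<tau>\<^sup>2 / (1 - 2 * ?a * K * \<tau>) * real n * trace A
      \<le> 2 * c * K * \<tau>\<^sup>2 / (1 - 2 * c * K * \<bar>\<tau>\<bar>) * real n * c"
    using A le \<tau> K c0 a0 trace_psd_nonneg[OF A(1)]
    by (intro mult_mono frac_le mult_right_mono mult_left_mono mult_nonneg_nonneg divide_nonneg_pos) auto
  also have "\<dots> = 2 * c\<^sup>2 * K * \<tau>\<^sup>2 * real n / (1 - 2 * c * K * \<bar>\<tau>\<bar>)"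
    by (simp add: power2_eq_square)
  finally have "exp (2 * ?a * K * \<tau>\<^sup>2 / (1 - 2 * ?a * K * \<tau>) * real n * trace A)
      \<le> exp (2 * c\<^sup>2 * K * \<tau>\<^sup>2 * real n / (1 - 2 * c * K * \<bar>\<tau>\<bar>))" by simp
  note order_trans[OF bnd this]
  moreover have "(\<integral>\<^sup>+\<omega>. ennreal (exp (\<tau> * trace (A ** W \<omega>))) \<partial>P) = ennreal (\<integral>\<omega>. exp (\<tau> * trace (A ** W \<omega>)) \<partial>P)"
    by (rule nn_integral_eq_integral[OF int]) simp
  ultimately show ?thesis by (metis ennreal_leI)
qed

text \<open>Jensen's inequality without an integrability condition on the exponential.\<close>

lemma (in prob_space) exp_expectation_le:
  assumes X: "integrable M X"
  shows "ennreal (exp (expectation X)) \<le> (\<integral>\<^sup>+x. ennreal (exp (X x)) \<partial>M)"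
proof (cases "integrable M (\<lambda>x. exp (X x))")
  case True
  have "exp (expectation X) \<le> expectation (\<lambda>x. exp (X x))"
    using X True exp_convex by (intro jensens_inequality[where I = UNIV]) auto
  then show ?thesis by (subst nn_integral_eq_integral[OF True]) (auto intro: ennreal_leI)
next
  case False
  have [measurable]: "X \<in> borel_measurable M" using X by auto
  have "(\<integral>\<^sup>+x. ennreal (exp (X x)) \<partial>M) = \<infinity>"
  proof (rule ccontr)
    assume "(\<integral>\<^sup>+x. ennreal (exp (X x)) \<partial>M) \<noteq> \<infinity>"
    then have "integrable M (\<lambda>x. exp (X x))" by (intro integrableI_nonneg) (simp_all add: less_top)
    with False show False ..
  qed
  then show ?thesis by simp
qed

text \<open>The matrix that accounts for the randomness of the posterior: replacing \<open>u\<close> by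
\<open>u + h\<close> with \<open>h\<close> centred adds \<open>trace (second_moment \<rho> S ** W)\<close> to the expected quadratic form,
and this term does not depend on \<open>u\<close>.\<close>

definition second_moment :: "(real^'n) measure \<Rightarrow> real^'n^'n \<Rightarrow> real^'n^'n" where
  "second_moment \<rho> S = (\<integral>h. outer (S *v h) (S *v h) \<partial>\<rho>)"

lemma matrix_vector_mult_measurable [measurable]:
  fixes f :: "'a \<Rightarrow> real^'n^'m"
  assumes "f \<in> borel_measurable M" "g \<in> borel_measurable M"
  shows "(\<lambda>x. f x *v g x) \<in> borel_measurable M"
  using assms by (rule borel_measurable_continuous_Pair)
    (intro bounded_bilinear.continuous_on[OF bounded_bilinear_matrix_vector_mult] continuous_intros)

lemma outer_measurable [measurable]:
  assumes "f \<in> borel_measurable M" "g \<in> borel_measurable M"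
  shows "(\<lambda>x. outer (f x) (g x)) \<in> borel_measurable M"
  using assms by (rule borel_measurable_continuous_Pair)
    (intro bounded_bilinear.continuous_on[OF bounded_bilinear_outer] continuous_intros)

lemma integrable_outer:
  fixes S :: "real^'n^'n"
  assumes [measurable_cong]: "sets \<rho> = sets borel" and int: "integrable \<rho> (\<lambda>h. (norm h)\<^sup>2)"
  shows "integrable \<rho> (\<lambda>h. outer (S *v h) (S *v h))"
proof -
  obtain B where B: "\<And>v w :: real^'n. norm (outer v w) \<le> norm v * norm w * B" "B > 0"
    using bounded_bilinear.pos_bounded[OF bounded_bilinear_outer[where 'n='n]] by blast
  have "norm (outer (S *v h) (S *v h)) \<le> ((opnorm S)\<^sup>2 * B) * (norm h)\<^sup>2" for h
  proof -
    have "norm (outer (S *v h) (S *v h)) \<le> norm (S *v h) * norm (S *v h) * B" by (rule B)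
    also have "\<dots> \<le> (opnorm S * norm h) * (opnorm S * norm h) * B"
      using B(2) by (intro mult_right_mono mult_mono norm_matrix_vector_le) (auto simp: opnorm_nonneg)
    finally show ?thesis by (simp add: power2_eq_square mult_ac)
  qed
  then show ?thesis
    using B(2) by (intro Bochner_Integration.integrable_bound[OF integrable_mult_right[OF int, of "(opnorm S)\<^sup>2 * B"]])
      (auto intro!: AE_I2 simp: abs_mult)
qed

lemma second_moment_bounds:
  fixes S :: "real^'n^'n"
  assumes \<rho>: "prob_space \<rho>" and sets [measurable_cong]: "sets \<rho> = sets borel"
    and int: "integrable \<rho> (\<lambda>h. (norm h)\<^sup>2)" and a: "AE h in \<rho>. (norm (S *v h))\<^sup>2 \<le> a"
  shows "psd (second_moment \<rho> S)" "opnorm (second_moment \<rho> S) \<le> a" "trace (second_moment \<rho> S) \<le> a"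
proof -
  interpret \<rho>: prob_space \<rho> by fact
  note O = integrable_outer[OF sets int, of S]
  let ?C = "second_moment \<rho> S"
  have sym: "transpose ?C = ?C"
    unfolding second_moment_def by (subst integral_bounded_linear[OF bounded_linear_transpose O, symmetric]) (simp add: transpose_outer)
  have iq: "integrable \<rho> (\<lambda>h. ((S *v h) \<bullet> x)\<^sup>2)" for x
    using integrable_bounded_linear[OF bounded_linear_quadratic O, of x] by (simp add: outer_mult_vec power2_eq_square inner_commute)
  have quad: "x \<bullet> (?C *v x) = (\<integral>h. ((S *v h) \<bullet> x)\<^sup>2 \<partial>\<rho>)" for x
    unfolding second_moment_def
    by (subst integral_bounded_linear[OF bounded_linear_quadratic O, symmetric]) (simp add: outer_mult_vec power2_eq_square inner_commute)
  show psd: "psd ?C" by (simp add: psd_def sym quad)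
  have "AE h in \<rho>. 0 \<le> a" using a by eventually_elim (meson order_trans zero_le_power2)
  then have a0: "a \<ge> 0" by simp
  show "opnorm ?C \<le> a"
  proof (rule opnorm_symmetric_le[OF sym a0])
    fix x
    have "(\<integral>h. ((S *v h) \<bullet> x)\<^sup>2 \<partial>\<rho>) \<le> (\<integral>h. a * (x \<bullet> x) \<partial>\<rho>)"
    proof (rule integral_mono_AE)
      show "AE h in \<rho>. ((S *v h) \<bullet> x)\<^sup>2 \<le> a * (x \<bullet> x)"
        using a
      proof eventually_elim
        case (elim h)
        have "((S *v h) \<bullet> x)\<^sup>2 \<le> ((S *v h) \<bullet> (S *v h)) * (x \<bullet> x)" by (rule Cauchy_Schwarz_ineq)
        also have "\<dots> \<le> a * (x \<bullet> x)" using elim by (intro mult_right_mono) (auto simp: dot_square_norm)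
        finally show ?case .
      qed
    qed (auto simp: iq)
    then show "\<bar>x \<bullet> (?C *v x)\<bar> \<le> a * (x \<bullet> x)" using \<rho>.prob_space by (simp add: quad)
  qed
  have "trace ?C = (\<integral>h. (norm (S *v h))\<^sup>2 \<partial>\<rho>)"
    unfolding second_moment_def
    by (subst integral_bounded_linear[OF bounded_linear_trace O, symmetric]) (simp add: trace_outer dot_square_norm)
  also have "\<dots> \<le> (\<integral>h. a \<partial>\<rho>)"
    using a integrable_bounded_linear[OF bounded_linear_trace O]
    by (intro integral_mono_AE) (auto simp: trace_outer dot_square_norm)
  finally show "trace ?C \<le> a" using \<rho>.prob_space by simp
qed

text \<open>The variational step. The right-hand side does not depend on \<open>u\<close>, so after taking
the expectation over \<open>W\<close> it controls all directions \<open>u\<close> simultaneously. The inequality is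
Jensen's, applied to the law of \<open>u + h\<close>; the linear terms in \<open>h\<close> average out, and the Gaussian
density ratio costs \<open>\<beta> * (u \<bullet> u) / 2\<close>.\<close>

lemma pac_bayes_quadratic:
  fixes S W :: "real^'n^'n"
  assumes \<rho>: "prob_space \<rho>" and sets [measurable_cong]: "sets \<rho> = sets borel"
    and int: "integrable \<rho> (\<lambda>h. (norm h)\<^sup>2)" and a: "AE h in \<rho>. (norm (S *v h))\<^sup>2 \<le> a"
    and mean: "(\<integral>h. h \<partial>\<rho>) = 0"
    and shift: "\<And>f u. f \<in> borel_measurable borel \<Longrightarrow>
      (\<integral>\<^sup>+h. f (u + h) * ennreal (exp (- \<beta> * (u \<bullet> u) / 2 - \<beta> * (u \<bullet> h))) \<partial>\<rho>) \<le> 2 * (\<integral>\<^sup>+y. f y \<partial>gauss \<beta>)"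
    and b: "(norm (S *v u))\<^sup>2 \<le> b"
  shows "ennreal (exp (\<tau> * ((S *v u) \<bullet> (W *v (S *v u))) + \<tau> * trace (second_moment \<rho> S ** W) - \<beta> * (u \<bullet> u) / 2))
    \<le> 2 * (\<integral>\<^sup>+y. ennreal (exp (\<tau> * ((S *v y) \<bullet> (W *v (S *v y))))) *
         indicator {y. (norm (S *v y))\<^sup>2 \<le> 2 * (a + b)} y \<partial>gauss \<beta>)"
proof -
  interpret \<rho>: prob_space \<rho> by fact
  define q where "q y = (S *v y) \<bullet> (W *v (S *v y))" for y
  define g where "g h = \<tau> * ((S *v u) \<bullet> (W *v (S *v h)) + (S *v h) \<bullet> (W *v (S *v u))) - \<beta> * (u \<bullet> h)" for h
  define X where "X h = (\<tau> * q u - \<beta> * (u \<bullet> u) / 2) + g h + \<tau> * trace (outer (S *v h) (S *v h) ** W)" for h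
  have X: "\<tau> * q (u + h) + (- \<beta> * (u \<bullet> u) / 2 - \<beta> * (u \<bullet> h)) = X h" for h
    by (simp add: X_def g_def q_def trace_outer_mult matrix_vector_right_distrib inner_simps algebra_simps)
  have id: "integrable \<rho> (\<lambda>h. h)"
  proof (rule Bochner_Integration.integrable_bound)
    show "integrable \<rho> (\<lambda>h. 1 + (norm h)\<^sup>2)" using int by auto
    have "norm h \<le> 1 + (norm h)\<^sup>2" for h :: "real^'n"
      using sum_power2_ge_zero[of "norm h - 1/2" 0] by (simp add: power2_eq_square algebra_simps)
    then show "AE h in \<rho>. norm h \<le> norm (1 + (norm h)\<^sup>2)" by auto
  qed auto
  have g: "bounded_linear g"
    unfolding g_def linear_conv_bounded_linear[symmetric] linear_iff
    by (auto simp: matrix_vector_right_distrib matrix_vector_mult_scaleR inner_simps algebra_simps)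
  have gi: "integrable \<rho> g" by (rule integrable_bounded_linear[OF g id])
  have "(\<integral>h. g h \<partial>\<rho>) = g (\<integral>h. h \<partial>\<rho>)"
    by (rule integral_bounded_linear[OF g id])
  then have g0: "(\<integral>h. g h \<partial>\<rho>) = 0" using mean linear_0[OF bounded_linear.linear[OF g]] by simp
  have tr: "bounded_linear (\<lambda>A. trace (A ** W))"
    by (intro bounded_linear_compose[OF bounded_linear_trace] bounded_bilinear.bounded_linear_left bounded_bilinear_matrix_mult)
  note O = integrable_outer[OF sets int, of S]
  have Xi: "integrable \<rho> X"
    unfolding X_def using gi integrable_bounded_linear[OF tr O] by auto
  have EX: "\<rho>.expectation X = \<tau> * q u + \<tau> * trace (second_moment \<rho> S ** W) - \<beta> * (u \<bullet> u) / 2"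
    unfolding X_def using gi integrable_bounded_linear[OF tr O] \<rho>.prob_space
    by (simp add: g0 integral_bounded_linear[OF tr O] second_moment_def)
  define f where "f y = ennreal (exp (\<tau> * q y)) * indicator {y. (norm (S *v y))\<^sup>2 \<le> 2 * (a + b)} y" for y
  have f: "f \<in> borel_measurable borel" unfolding f_def q_def by measurable
  have "ennreal (exp (\<rho>.expectation X)) \<le> (\<integral>\<^sup>+h. ennreal (exp (X h)) \<partial>\<rho>)"
    by (rule \<rho>.exp_expectation_le[OF Xi])
  also have "\<dots> \<le> (\<integral>\<^sup>+h. f (u + h) * ennreal (exp (- \<beta> * (u \<bullet> u) / 2 - \<beta> * (u \<bullet> h))) \<partial>\<rho>)"
  proof (rule nn_integral_mono_AE)
    show "AE h in \<rho>. ennreal (exp (X h)) \<le> f (u + h) * ennreal (exp (- \<beta> * (u \<bullet> u) / 2 - \<beta> * (u \<bullet> h)))"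
      using a
    proof eventually_elim
      case (elim h)
      \<comment> \<open>the parallelogram law shows that the translate stays in the region kept by the indicator\<close>
      have "(norm (S *v u + S *v h))\<^sup>2 + (norm (S *v u - S *v h))\<^sup>2 = 2 * (norm (S *v u))\<^sup>2 + 2 * (norm (S *v h))\<^sup>2"
        by (simp add: power2_norm_eq_inner inner_simps inner_commute)
      moreover have "(norm (S *v u - S *v h))\<^sup>2 \<ge> 0" by simp
      moreover have "p + m = 2 * y + 2 * z \<Longrightarrow> 0 \<le> m \<Longrightarrow> z \<le> a \<Longrightarrow> y \<le> b \<Longrightarrow> p \<le> 2 * (a + b)" for p m y z :: real
        by (simp add: algebra_simps)
      ultimately have "(norm (S *v u + S *v h))\<^sup>2 \<le> 2 * (a + b)" using elim b by blast
      then have "(norm (S *v (u + h)))\<^sup>2 \<le> 2 * (a + b)"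
        by (simp only: matrix_vector_right_distrib)
      then have "f (u + h) = ennreal (exp (\<tau> * q (u + h)))" by (simp add: f_def)
      then show ?case unfolding X[symmetric] exp_add by (simp add: ennreal_mult'')
    qed
  qed
  also have "\<dots> \<le> 2 * (\<integral>\<^sup>+y. f y \<partial>gauss \<beta>)" by (rule shift[OF f])
  finally show ?thesis unfolding EX by (simp add: f_def q_def)
qed

section \<open>The uniform deviation inequality\<close>

text \<open>The choices are \<open>\<beta> = 4 * r\<close>, which makes the random perturbation \<open>S h\<close> of squared length
at most \<open>s / 2\<close> (so that the posterior lives in a ball of squared radius \<open>3 * s\<close>) at an entropy
cost of only \<open>2 * r\<close>, and a single \<open>\<tau>\<close> proportional to \<open>sqrt (D / (K * n)) / s\<close> with
\<open>D = 9 * r + 4 * t\<close>. Both exponential moments are then bounded by small multiples of \<open>D\<close>. The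
size condition on \<open>n\<close> keeps \<open>\<tau>\<close> away from the singularity of the Bernstein bound. Four
nonnegative variables, namely the Gaussian mixture and the exponential of the trace correction
for either sign of \<open>\<tau>\<close>, are normalised and added, so a single application of Markov's inequality at level
\<open>4 * exp t\<close> handles all of them. The set \<open>B\<close> is produced explicitly because the supremum over
\<open>u\<close> is an uncountable one.\<close>

lemma uniform_quadratic_deviation:
  fixes W :: "'a \<Rightarrow> real^'n^'n" and S :: "real^'n^'n"
  assumes P: "prob_space P" and [measurable]: "W \<in> borel_measurable P"
    and W: "trace_bernstein P W K n" and K: "K > 0" and n: "n > 0" and t: "t \<ge> 0"
    and s: "s > 0" and S: "\<And>u. (norm (S *v u))\<^sup>2 \<le> s * (norm u)\<^sup>2"
    and r: "(\<Sum>b\<in>Basis. (norm (S *v b))\<^sup>2) = s * r" "r \<ge> 1"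
    and large: "real n \<ge> 2 * K * (9 * r + 4 * t)"
  obtains B where "B \<in> sets P" "emeasure P B \<le> ennreal (exp (- t))"
    "\<And>\<omega> u. \<omega> \<in> space P - B \<Longrightarrow> norm u = 1 \<Longrightarrow>
      \<bar>(S *v u) \<bullet> (W \<omega> *v (S *v u))\<bar> \<le> 12 * s * real n * sqrt (K * (9 * r + 4 * t) / n)"
proof -
  interpret P: prob_space P by fact
  define D where "D = 9 * r + 4 * t"
  define x where "x = sqrt (K * D / n)"
  define \<tau> where "\<tau> = x / (10 * s * K)"
  have D: "D \<ge> 9" using r t by (simp add: D_def)
  have x2: "x\<^sup>2 = K * D / n" using K D n by (simp add: x_def)
  have x0: "x > 0" using K D n by (simp add: x_def)
  have "x\<^sup>2 \<le> 1 / 2" unfolding x2 using large n by (simp add: D_def field_simps)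
  also have "\<dots> \<le> (71 / 100)\<^sup>2" by (simp add: power2_eq_square)
  finally have x1: "x \<le> 71 / 100" by (rule power2_le_imp_le) simp
  have \<tau>0: "\<tau> > 0" using x0 s K by (simp add: \<tau>_def)
  have sK\<tau>: "s * K * \<tau> = x / 10" using s K by (simp add: \<tau>_def)
  have sK\<tau>2: "s\<^sup>2 * K * \<tau>\<^sup>2 * n = D / 100"
  proof -
    have "K * (s\<^sup>2 * K * \<tau>\<^sup>2 * n) = (s * K * \<tau>)\<^sup>2 * n" by (simp add: power2_eq_square)
    also have "\<dots> = K * (D / 100)" using n by (simp add: sK\<tau> power_divide x2)
    finally show ?thesis using K by simp
  qed

  define \<beta> where "\<beta> = 4 * r"
  have \<beta>: "\<beta> > 0" using r by (simp add: \<beta>_def)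
  interpret G: prob_space "gauss \<beta> :: (real^'n) measure" by (rule prob_space_gauss[OF \<beta>])
  interpret pair_sigma_finite P "gauss \<beta> :: (real^'n) measure" ..
  have half: "2 * (\<Sum>b\<in>Basis. (norm (S *v b))\<^sup>2) / \<beta> = s / 2"
    using r by (simp add: \<beta>_def)
  obtain \<rho> where \<rho>: "prob_space \<rho>" "sets \<rho> = sets borel" "AE h in \<rho>. (norm (S *v h))\<^sup>2 \<le> s / 2"
    "integrable \<rho> (\<lambda>h. (norm h)\<^sup>2)" "(\<integral>h. h \<partial>\<rho>) = 0"
    "\<And>f u. f \<in> borel_measurable borel \<Longrightarrow>
      (\<integral>\<^sup>+h. f (u + h) * ennreal (exp (- \<beta> * (u \<bullet> u) / 2 - \<beta> * (u \<bullet> h))) \<partial>\<rho>) \<le> 2 * (\<integral>\<^sup>+y. f y \<partial>gauss \<beta>)"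
    by (rule truncated_gauss[OF \<beta>, of "(*v) S", unfolded half, OF matrix_vector_mul_linear]) (rule that)
  define C where "C = second_moment \<rho> S"
  note C = second_moment_bounds[OF \<rho>(1,2,4,3), folded C_def]

  define Z where "Z \<sigma> \<omega> = (\<integral>\<^sup>+y. ennreal (exp (\<sigma> * \<tau> * ((S *v y) \<bullet> (W \<omega> *v (S *v y))))) *
      indicator {y. (norm (S *v y))\<^sup>2 \<le> 2 * (s / 2 + s)} y \<partial>gauss \<beta>)" for \<sigma> \<omega>
  define Y where "Y \<sigma> \<omega> = ennreal (exp (\<sigma> * \<tau> * trace (C ** W \<omega>)))" for \<sigma> \<omega>

  have joint: "(\<lambda>(\<omega>, y). ennreal (exp (\<sigma> * \<tau> * ((S *v y) \<bullet> (W \<omega> *v (S *v y))))) *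
      indicator {y. (norm (S *v y))\<^sup>2 \<le> 2 * (s / 2 + s)} y) \<in> borel_measurable (P \<Otimes>\<^sub>M gauss \<beta>)" for \<sigma>
    by measurable
  have [measurable]: "Z \<sigma> \<in> borel_measurable P" for \<sigma>
    unfolding Z_def using joint[of \<sigma>] by (intro G.borel_measurable_nn_integral) simp
  have CW: "bounded_linear (\<lambda>A. trace (C ** A))"
    by (intro bounded_linear_compose[OF bounded_linear_trace] bounded_bilinear.bounded_linear_right bounded_bilinear_matrix_mult)
  have [measurable]: "(\<lambda>\<omega>. trace (C ** W \<omega>)) \<in> borel_measurable P"
    by (rule borel_measurable_continuous_on[OF linear_continuous_on[OF CW]]) measurable
  have [measurable]: "Y \<sigma> \<in> borel_measurable P" for \<sigma>
    unfolding Y_def by measurable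

  have Z: "(\<integral>\<^sup>+\<omega>. Z \<sigma> \<omega> \<partial>P) \<le> ennreal (exp (32 / 100 * D))" if \<sigma>: "\<bar>\<sigma>\<bar> = 1" for \<sigma>
  proof -
    have st: "\<bar>\<sigma> * \<tau>\<bar> = \<tau>" "(\<sigma> * \<tau>)\<^sup>2 = \<tau>\<^sup>2"
      using \<sigma> \<tau>0 by (auto simp: abs_mult power_mult_distrib power2_eq_1_iff abs_if split: if_splits)
    have "2 * (3 * s) * K * \<bar>\<sigma> * \<tau>\<bar> = 6 * (s * K * \<tau>)" by (simp add: st)
    then have e1: "2 * (3 * s) * K * \<bar>\<sigma> * \<tau>\<bar> = 6 / 10 * x" by (simp add: sK\<tau>)
    then have lt: "2 * (3 * s) * K * \<bar>\<sigma> * \<tau>\<bar> < 1" using x1 by linarith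
    have "2 * (3 * s)\<^sup>2 * K * (\<sigma> * \<tau>)\<^sup>2 * n = 18 * (s\<^sup>2 * K * \<tau>\<^sup>2 * n)"
      unfolding st by (simp add: power_mult_distrib)
    then have "2 * (3 * s)\<^sup>2 * K * (\<sigma> * \<tau>)\<^sup>2 * n = 18 / 100 * D"
      unfolding sK\<tau>2 by simp
    then have "2 * (3 * s)\<^sup>2 * K * (\<sigma> * \<tau>)\<^sup>2 * n / (1 - 2 * (3 * s) * K * \<bar>\<sigma> * \<tau>\<bar>) = 18 / 100 * D / (1 - 6 / 10 * x)"
      unfolding e1 by (simp only:)
    also have "\<dots> \<le> 18 / 100 * D / (57 / 100)" using x1 D by (intro divide_left_mono) auto
    also have "\<dots> \<le> 32 / 100 * D" using D by simp
    finally have e2: "2 * (3 * s)\<^sup>2 * K * (\<sigma> * \<tau>)\<^sup>2 * n / (1 - 2 * (3 * s) * K * \<bar>\<sigma> * \<tau>\<bar>) \<le> 32 / 100 * D" .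
    have "(\<integral>\<^sup>+\<omega>. ennreal (exp (\<sigma> * \<tau> * ((S *v y) \<bullet> (W \<omega> *v (S *v y))))) *
        indicator {y. (norm (S *v y))\<^sup>2 \<le> 2 * (s / 2 + s)} y \<partial>P) \<le> ennreal (exp (32 / 100 * D))" for y
    proof (cases "(norm (S *v y))\<^sup>2 \<le> 2 * (s / 2 + s)")
      case True
      then have "(S *v y) \<bullet> (S *v y) \<le> 3 * s" by (simp add: dot_square_norm)
      then have "(\<integral>\<^sup>+\<omega>. ennreal (exp (\<sigma> * \<tau> * trace (outer (S *v y) (S *v y) ** W \<omega>))) \<partial>P)
        \<le> ennreal (exp (2 * (3 * s)\<^sup>2 * K * (\<sigma> * \<tau>)\<^sup>2 * n / (1 - 2 * (3 * s) * K * \<bar>\<sigma> * \<tau>\<bar>)))"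
        using opnorm_outer_le[of "S *v y"]
        by (intro trace_bernstein_uniform[OF W K psd_outer _ _ lt]) (simp_all add: trace_outer)
      also have "\<dots> \<le> ennreal (exp (32 / 100 * D))" using e2 by (intro ennreal_leI) (simp only: exp_le_cancel_iff)
      finally show ?thesis using True by (simp add: trace_outer_mult)
    qed auto
    then have "(\<integral>\<^sup>+y. (\<integral>\<^sup>+\<omega>. ennreal (exp (\<sigma> * \<tau> * ((S *v y) \<bullet> (W \<omega> *v (S *v y))))) *
        indicator {y. (norm (S *v y))\<^sup>2 \<le> 2 * (s / 2 + s)} y \<partial>P) \<partial>gauss \<beta>)
        \<le> (\<integral>\<^sup>+y. ennreal (exp (32 / 100 * D)) \<partial>(gauss \<beta> :: (real^'n) measure))"
      by (intro nn_integral_mono)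
    also have "\<dots> = ennreal (exp (32 / 100 * D))"
      using G.emeasure_space_1 by simp
    finally show ?thesis unfolding Z_def Fubini'[OF joint] .
  qed
  have Y: "(\<integral>\<^sup>+\<omega>. Y \<sigma> \<omega> \<partial>P) \<le> ennreal (exp (1 / 100 * D))" if \<sigma>: "\<bar>\<sigma>\<bar> = 1" for \<sigma>
  proof -
    have st: "\<bar>\<sigma> * \<tau>\<bar> = \<tau>" "(\<sigma> * \<tau>)\<^sup>2 = \<tau>\<^sup>2"
      using \<sigma> \<tau>0 by (auto simp: abs_mult power_mult_distrib power2_eq_1_iff abs_if split: if_splits)
    have "2 * (s / 2) * K * \<bar>\<sigma> * \<tau>\<bar> = s * K * \<tau>" by (simp add: st)
    then have e1: "2 * (s / 2) * K * \<bar>\<sigma> * \<tau>\<bar> = 1 / 10 * x" by (simp add: sK\<tau>)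
    then have lt: "2 * (s / 2) * K * \<bar>\<sigma> * \<tau>\<bar> < 1" using x1 by linarith
    have "2 * (s / 2)\<^sup>2 * K * (\<sigma> * \<tau>)\<^sup>2 * n = 1 / 2 * (s\<^sup>2 * K * \<tau>\<^sup>2 * n)"
      unfolding st by (simp add: power_divide)
    then have "2 * (s / 2)\<^sup>2 * K * (\<sigma> * \<tau>)\<^sup>2 * n = 1 / 200 * D"
      unfolding sK\<tau>2 by simp
    then have "2 * (s / 2)\<^sup>2 * K * (\<sigma> * \<tau>)\<^sup>2 * n / (1 - 2 * (s / 2) * K * \<bar>\<sigma> * \<tau>\<bar>) = 1 / 200 * D / (1 - 1 / 10 * x)"
      unfolding e1 by (simp only:)
    also have "\<dots> \<le> 1 / 200 * D / (1 / 2)" using x1 D by (intro divide_left_mono) auto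
    also have "\<dots> \<le> 1 / 100 * D" using D by simp
    finally have e2: "2 * (s / 2)\<^sup>2 * K * (\<sigma> * \<tau>)\<^sup>2 * n / (1 - 2 * (s / 2) * K * \<bar>\<sigma> * \<tau>\<bar>) \<le> 1 / 100 * D" .
    have "(\<integral>\<^sup>+\<omega>. Y \<sigma> \<omega> \<partial>P)
        \<le> ennreal (exp (2 * (s / 2)\<^sup>2 * K * (\<sigma> * \<tau>)\<^sup>2 * n / (1 - 2 * (s / 2) * K * \<bar>\<sigma> * \<tau>\<bar>)))"
      unfolding Y_def by (rule trace_bernstein_uniform[OF W K C lt])
    also have "\<dots> \<le> ennreal (exp (1 / 100 * D))" using e2 by (intro ennreal_leI) (simp only: exp_le_cancel_iff)
    finally show ?thesis .
  qed

  define e1 e2 where "e1 = exp (- (32 / 100 * D))" and "e2 = exp (- (1 / 100 * D))"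
  have e0: "e1 \<ge> 0" "e2 \<ge> 0" by (simp_all add: e1_def e2_def)
  define V where "V \<omega> = ennreal e1 * Z 1 \<omega> + ennreal e1 * Z (-1) \<omega> + (ennreal e2 * Y 1 \<omega> + ennreal e2 * Y (-1) \<omega>)" for \<omega>
  have [measurable]: "V \<in> borel_measurable P" unfolding V_def by measurable
  have Ve: "ennreal e1 * ennreal (exp (32 / 100 * D)) = 1" "ennreal e2 * ennreal (exp (1 / 100 * D)) = 1"
    by (simp_all add: e1_def e2_def ennreal_mult''[symmetric] exp_minus)
  have le1: "ennreal e1 * (\<integral>\<^sup>+\<omega>. Z \<sigma> \<omega> \<partial>P) \<le> 1" "ennreal e2 * (\<integral>\<^sup>+\<omega>. Y \<sigma> \<omega> \<partial>P) \<le> 1" if "\<bar>\<sigma>\<bar> = 1" for \<sigma>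
    using mult_left_mono[OF Z[OF that], of "ennreal e1"] mult_left_mono[OF Y[OF that], of "ennreal e2"]
    by (simp_all only: Ve zero_le)
  have "(\<integral>\<^sup>+\<omega>. V \<omega> \<partial>P) = ennreal e1 * (\<integral>\<^sup>+\<omega>. Z 1 \<omega> \<partial>P) + ennreal e1 * (\<integral>\<^sup>+\<omega>. Z (-1) \<omega> \<partial>P)
      + (ennreal e2 * (\<integral>\<^sup>+\<omega>. Y 1 \<omega> \<partial>P) + ennreal e2 * (\<integral>\<^sup>+\<omega>. Y (-1) \<omega> \<partial>P))"
    unfolding V_def by (simp add: nn_integral_add nn_integral_cmult)
  also have "\<dots> \<le> (1 + 1) + (1 + 1)"
    by (intro add_mono le1) simp_all
  finally have "(\<integral>\<^sup>+\<omega>. V \<omega> \<partial>P) \<le> (1 + 1) + (1 + 1)" .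
  then have V: "(\<integral>\<^sup>+\<omega>. V \<omega> \<partial>P) \<le> 4" by simp

  define B where "B = {\<omega>\<in>space P. 1 \<le> ennreal (exp (- t) / 4) * V \<omega>}"
  show ?thesis
  proof (rule that[of B])
    show "B \<in> sets P" unfolding B_def by measurable
    have "emeasure P B \<le> ennreal (exp (- t) / 4) * (\<integral>\<^sup>+\<omega>. V \<omega> * indicator (space P) \<omega> \<partial>P)"
      unfolding B_def by (rule nn_integral_Markov_inequality) auto
    also have "(\<integral>\<^sup>+\<omega>. V \<omega> * indicator (space P) \<omega> \<partial>P) = (\<integral>\<^sup>+\<omega>. V \<omega> \<partial>P)"
      by (intro nn_integral_cong) simp
    also have "ennreal (exp (- t) / 4) * \<dots> \<le> ennreal (exp (- t) / 4) * ennreal 4"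
      using V by (intro mult_left_mono) auto
    also have "\<dots> = ennreal (exp (- t))" by (simp add: ennreal_mult''[symmetric] del: ennreal_numeral)
    finally show "emeasure P B \<le> ennreal (exp (- t))" .
  next
    fix \<omega> and u :: "real^'n" assume \<omega>: "\<omega> \<in> space P - B" and u: "norm u = 1"
    define q where "q = (S *v u) \<bullet> (W \<omega> *v (S *v u))"
    have Vlt: "ennreal (exp (- t) / 4) * V \<omega> < 1" using \<omega> by (auto simp: B_def not_le)
    have two: "2 \<le> exp (1::real)" using exp_ge_add_one_self[of 1] by simp
    have "2 ^ 2 \<le> exp (1::real) ^ 2" "2 ^ 3 \<le> exp (1::real) ^ 3" using two by (intro power_mono; simp)+
    then have e4: "4 \<le> exp (2::real)" and e8: "8 \<le> exp (3::real)" by (simp_all add: exp_of_nat_mult[symmetric])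
    have small: "y \<le> V \<omega> \<Longrightarrow> ennreal (exp (- t) / 4) * y < 1" for y
      using Vlt by (meson le_less_trans mult_left_mono zero_le)
    have key: "\<sigma> * \<tau> * q \<le> 111 / 100 * D" if \<sigma>: "\<sigma> \<in> {1, -1}" for \<sigma>
    proof -
      define A where "A = \<sigma> * \<tau> * q + \<sigma> * \<tau> * trace (C ** W \<omega>) - \<beta> * (u \<bullet> u) / 2"
      \<comment> \<open>the mixture bounds the form plus the trace correction, and the correction is removed
        with the variable of opposite sign\<close>
      have "(norm (S *v u))\<^sup>2 \<le> s" using S[of u] u by simp
      from pac_bayes_quadratic[OF \<rho>(1,2,4,3,5,6) this, of "\<sigma> * \<tau>" "W \<omega>"]
      have ZA: "ennreal (exp A) \<le> 2 * Z \<sigma> \<omega>"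
        by (simp only: Z_def q_def A_def C_def)
      have "ennreal e1 * Z \<sigma> \<omega> \<le> V \<omega>" using \<sigma> unfolding V_def by (auto simp: add_increasing add_increasing2)
      then have z: "ennreal (exp (- t) / 4) * (ennreal e1 * Z \<sigma> \<omega>) < 1" by (rule small)
      have "ennreal (exp (- t) / 4 * e1 * exp A) = ennreal (exp (- t) / 4) * ennreal e1 * ennreal (exp A)"
        by (simp only: ennreal_mult'' e0 exp_ge_zero)
      also have "\<dots> \<le> ennreal (exp (- t) / 4) * ennreal e1 * (2 * Z \<sigma> \<omega>)"
        using ZA by (intro mult_left_mono) auto
      also have "\<dots> = 2 * (ennreal (exp (- t) / 4) * (ennreal e1 * Z \<sigma> \<omega>))" by (simp add: mult_ac)
      also have "\<dots> \<le> 2 * 1" using z by (intro mult_left_mono) auto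
      finally have "ennreal (exp (- t) / 4 * e1 * exp A) \<le> ennreal 2" by simp
      then have "exp (- t) / 4 * e1 * exp A \<le> 2" by (subst (asm) ennreal_le_iff) auto
      moreover have "exp (A - t - 32 / 100 * D) = 4 * (exp (- t) / 4 * e1 * exp A)"
        by (simp add: e1_def mult_exp_exp algebra_simps)
      ultimately have "exp (A - t - 32 / 100 * D) \<le> exp 3" using e8 by linarith
      then have A: "A \<le> t + 32 / 100 * D + 3" unfolding exp_le_cancel_iff by linarith
      have "ennreal e2 * Y (- \<sigma>) \<omega> \<le> V \<omega>" using \<sigma> unfolding V_def by (auto simp: add_increasing add_increasing2)
      then have "ennreal (exp (- t) / 4) * (ennreal e2 * Y (- \<sigma>) \<omega>) < 1" by (rule small)
      moreover have "ennreal (exp (- t) / 4 * e2 * exp (- \<sigma> * \<tau> * trace (C ** W \<omega>)))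
          = ennreal (exp (- t) / 4) * ennreal e2 * ennreal (exp (- \<sigma> * \<tau> * trace (C ** W \<omega>)))"
        by (simp only: ennreal_mult'' e0 exp_ge_zero)
      ultimately have "ennreal (exp (- t) / 4 * e2 * exp (- \<sigma> * \<tau> * trace (C ** W \<omega>))) < ennreal 1"
        by (simp only: Y_def ennreal_1 mult.assoc)
      then have "exp (- t) / 4 * e2 * exp (- \<sigma> * \<tau> * trace (C ** W \<omega>)) \<le> 1"
        by (subst (asm) ennreal_less_iff) (auto simp: e2_def)
      moreover have "exp (- \<sigma> * \<tau> * trace (C ** W \<omega>) - t - 1 / 100 * D)
          = 4 * (exp (- t) / 4 * e2 * exp (- \<sigma> * \<tau> * trace (C ** W \<omega>)))"
        by (simp add: e2_def mult_exp_exp algebra_simps)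
      ultimately have "exp (- \<sigma> * \<tau> * trace (C ** W \<omega>) - t - 1 / 100 * D) \<le> exp 2" using e4 by linarith
      then have "- \<sigma> * \<tau> * trace (C ** W \<omega>) \<le> t + 1 / 100 * D + 2" unfolding exp_le_cancel_iff by linarith
      moreover have "u \<bullet> u = 1" using u norm_eq_1 by blast
      ultimately have "\<sigma> * \<tau> * q \<le> 2 * t + 33 / 100 * D + 5 + 2 * r"
        using A by (simp add: A_def \<beta>_def)
      also have "\<dots> \<le> 111 / 100 * D"
      proof -
        \<comment> \<open>the additive constant 5 is absorbed by \<open>5 * r\<close>, as the effective rank is at least 1\<close>
        have "78 / 100 * D = 702 / 100 * r + 312 / 100 * t" by (simp add: D_def algebra_simps)
        then show ?thesis using r(2) t by linarith
      qed
      finally show ?thesis .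
    qed
    have "\<tau> * \<bar>q\<bar> \<le> 111 / 100 * D" using key[of 1] key[of "-1"] by (simp add: abs_if)
    then have "x * \<bar>q\<bar> \<le> 111 / 100 * D * (10 * s * K)" using s K by (simp add: \<tau>_def field_simps)
    also have "\<dots> = 111 / 10 * s * (K * D)" by simp
    also have "K * D = n * x\<^sup>2" using x2 n by simp
    also have "111 / 10 * s * (n * x\<^sup>2) \<le> 12 * s * (n * x\<^sup>2)" using s by (intro mult_right_mono) auto
    also have "\<dots> = x * (12 * s * n * x)" by (simp add: power2_eq_square)
    finally have "\<bar>q\<bar> \<le> 12 * s * n * x" using x0 by simp
    then show "\<bar>(S *v u) \<bullet> (W \<omega> *v (S *v u))\<bar> \<le> 12 * s * real n * sqrt (K * (9 * r + 4 * t) / n)"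
      by (simp add: q_def x_def D_def)
  qed
qed

section \<open>From the whitened sum to the sample covariance\<close>

text \<open>On the kernel of \<open>\<Sigma>\<close> the nonnegative quadratic form of \<open>M\<close> has mean zero, hence \<open>M\<close>
vanishes there. This is why no information is lost by whitening with a pseudo-inverse.\<close>

lemma AE_absorbs_range_projection:
  fixes M :: "'a \<Rightarrow> real^'n^'n"
  assumes psd: "AE \<omega> in P. psd (M \<omega>)" and int: "integrable P M" and E: "(\<integral>\<omega>. M \<omega> \<partial>P) = \<Sigma>"
    and Q: "\<Sigma> ** Q = \<Sigma>"
  shows "AE \<omega> in P. M \<omega> ** Q = M \<omega>"
proof -
  let ?y = "\<lambda>i. axis i 1 - Q *v axis i 1"
  have "AE \<omega> in P. M \<omega> *v ?y i = 0" for i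
  proof -
    have "\<Sigma> *v ?y i = 0"
      using Q by (simp add: matrix_vector_mult_diff_distrib matrix_vector_mul_assoc)
    then have "(\<integral>\<omega>. ?y i \<bullet> (M \<omega> *v ?y i) \<partial>P) = 0"
      by (subst integral_bounded_linear[OF bounded_linear_quadratic int]) (simp add: E)
    moreover have "AE \<omega> in P. 0 \<le> ?y i \<bullet> (M \<omega> *v ?y i)" using psd by eventually_elim (simp add: psd_def)
    ultimately have "AE \<omega> in P. ?y i \<bullet> (M \<omega> *v ?y i) = 0"
      using integral_nonneg_eq_0_iff_AE[OF integrable_bounded_linear[OF bounded_linear_quadratic int]] by blast
    with psd show ?thesis by eventually_elim (rule psd_kernel)
  qed
  then have "AE \<omega> in P. \<forall>i. M \<omega> *v ?y i = 0" by (simp add: AE_all_countable)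
  then show ?thesis
  proof eventually_elim
    case (elim \<omega>)
    have "column i (M \<omega> ** Q) = column i (M \<omega>)" for i
    proof -
      have "M \<omega> *v axis i 1 - (M \<omega> ** Q) *v axis i 1 = 0"
        using elim by (simp add: matrix_vector_mult_diff_distrib matrix_vector_mul_assoc)
      then show ?thesis by (simp add: matrix_vector_mult_basis)
    qed
    then show ?case by (simp add: vec_eq_iff column_def)
  qed
qed

lemma psd_integral:
  fixes M :: "'a \<Rightarrow> real^'n^'n"
  assumes psd: "AE \<omega> in P. psd (M \<omega>)" and int: "integrable P M"
  shows "psd (\<integral>\<omega>. M \<omega> \<partial>P)"
  unfolding psd_def
proof (intro conjI allI)
  have "transpose (\<integral>\<omega>. M \<omega> \<partial>P) = (\<integral>\<omega>. transpose (M \<omega>) \<partial>P)"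
    by (rule integral_bounded_linear[OF bounded_linear_transpose int, symmetric])
  also have "\<dots> = (\<integral>\<omega>. M \<omega> \<partial>P)"
    using psd integrable_bounded_linear[OF bounded_linear_transpose int] int
    by (intro integral_cong_AE) (auto simp: psd_def)
  finally show "transpose (\<integral>\<omega>. M \<omega> \<partial>P) = (\<integral>\<omega>. M \<omega> \<partial>P)" .
  fix x :: "real^'n"
  have "0 \<le> (\<integral>\<omega>. x \<bullet> (M \<omega> *v x) \<partial>P)"
    using psd by (intro integral_nonneg_AE) (auto simp: psd_def)
  then show "0 \<le> x \<bullet> ((\<integral>\<omega>. M \<omega> \<partial>P) *v x)"
    by (simp add: integral_bounded_linear[OF bounded_linear_quadratic int])
qed

theorem mainTheorem2:
  fixes P :: "'a measure"
    and M :: "nat \<Rightarrow> 'a \<Rightarrow> real^'p^'p"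
    and \<Sigma> :: "real^'p^'p"
    and K t :: real
    and n :: nat
  assumes "prob_space P"
    and "\<And>i. i \<in> {1..n} \<Longrightarrow> AE \<omega> in P. psd (M i \<omega>)"
    and "\<And>i. i \<in> {1..n} \<Longrightarrow> integrable P (M i)"
    and "\<And>i. i \<in> {1..n} \<Longrightarrow> (\<integral>\<omega>. M i \<omega> \<partial>P) = \<Sigma>"
    and "K > 0"
    and "\<And>(A :: real^'p^'p) (\<tau> :: real).
           psd A \<Longrightarrow> (A \<noteq> 0 \<Longrightarrow> \<tau> < 1 / (2 * opnorm A * K)) \<Longrightarrow>
           integrable P (\<lambda>\<omega>. exp (\<tau> * (\<Sum>i=1..n. trace (A **
             (psd_sqrt (pinv \<Sigma>) ** M i \<omega> ** psd_sqrt (pinv \<Sigma>)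
              - (\<integral>\<omega>'. psd_sqrt (pinv \<Sigma>) ** M i \<omega>' ** psd_sqrt (pinv \<Sigma>) \<partial>P)))))) \<and>
           (\<integral>\<omega>. exp (\<tau> * (\<Sum>i=1..n. trace (A **
             (psd_sqrt (pinv \<Sigma>) ** M i \<omega> ** psd_sqrt (pinv \<Sigma>)
              - (\<integral>\<omega>'. psd_sqrt (pinv \<Sigma>) ** M i \<omega>' ** psd_sqrt (pinv \<Sigma>) \<partial>P))))) \<partial>P)
           \<le> exp (2 * opnorm A * K * \<tau>\<^sup>2 / (1 - 2 * opnorm A * K * \<tau>) * real n * trace A)"
    and "t \<ge> 0"
    and "n > 0"
    and "real n \<ge> 2 * K * (9 * eff_rank \<Sigma> + 4 * t)"
  shows "measure P {\<omega> \<in> space P.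
           opnorm ((1 / real n) *\<^sub>R (\<Sum>i=1..n. M i \<omega>) - \<Sigma>)
           \<le> 12 * sqrt K * opnorm \<Sigma> * sqrt ((9 * eff_rank \<Sigma> + 4 * t) / real n)}
         \<ge> 1 - exp (- t)"
proof -
  note psd = assms(2) and int = assms(3) and mean = assms(4) and K = assms(5) and mgf = assms(6)
    and t = assms(7) and n = assms(8) and large = assms(9)
  interpret P: prob_space P by fact
  have psd\<Sigma>: "psd \<Sigma>" using psd_integral[OF psd int, of 1] mean[of 1] n by simp
  define T where "T = psd_sqrt (pinv \<Sigma>)"
  obtain S where S: "transpose S = S" "S ** S = \<Sigma>" "S ** T = T ** S" "\<Sigma> ** (S ** T) = \<Sigma>" "transpose T = T"
    unfolding T_def using psd_whitening[OF psd\<Sigma>] by blast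
  define Q where "Q = S ** T"
  have Qsym: "transpose Q = Q" by (simp add: Q_def matrix_transpose_mul S(1,5) S(3)[symmetric])
  define s where "s = opnorm \<Sigma>"
  define c where "c = 12 * s * sqrt (K * (9 * eff_rank \<Sigma> + 4 * t) / real n)"
  have c_eq: "12 * sqrt K * s * sqrt ((9 * eff_rank \<Sigma> + 4 * t) / real n) = c"
    by (simp add: c_def real_sqrt_mult[symmetric])
  define W where "W \<omega> = (\<Sum>i=1..n. T ** M i \<omega> ** T - (\<integral>\<omega>'. T ** M i \<omega>' ** T \<partial>P))" for \<omega>
  define H where "H \<omega> = (1 / real n) *\<^sub>R (\<Sum>i=1..n. M i \<omega>) - \<Sigma>" for \<omega>
  have Mm: "M i \<in> borel_measurable P" if "i \<in> {1..n}" for i using int[OF that] by auto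
  have Wm: "W \<in> borel_measurable P"
    unfolding W_def using integrable_bounded_linear[OF bounded_linear_sandwich int, of _ T]
    by (intro borel_measurable_sum borel_measurable_diff) auto
  have Hm: "H \<in> borel_measurable P"
    unfolding H_def using Mm by (intro borel_measurable_diff borel_measurable_scaleR borel_measurable_sum) auto

  have sand: "S ** (T ** X ** T) ** S = X" if "X ** Q = X" "transpose X = X" for X
  proof -
    have "Q ** X = transpose (X ** Q)" by (simp add: matrix_transpose_mul Qsym that(2))
    then have "Q ** X = X" using that by simp
    moreover have "S ** (T ** X ** T) ** S = (S ** T) ** X ** (T ** S)" by (simp add: matrix_mul_assoc)
    then have "S ** (T ** X ** T) ** S = (Q ** X) ** Q" by (simp only: S(3)[symmetric] Q_def)
    ultimately show ?thesis using that by simp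
  qed
  have sandwich_diff: "S ** (X - Y) ** S = S ** X ** S - S ** Y ** S" for X Y
    using linear_diff[OF bounded_linear.linear[OF bounded_linear_sandwich[of S]]] .
  have sandwich_sum: "S ** (\<Sum>i=1..n. f i) ** S = (\<Sum>i=1..n. S ** f i ** S)" for f
    using linear_sum[OF bounded_linear.linear[OF bounded_linear_sandwich[of S]]] .

  \<comment> \<open>almost surely the deviation is recovered from the whitened sum\<close>
  have H: "AE \<omega> in P. transpose (H \<omega>) = H \<omega> \<and> H \<omega> = (1 / real n) *\<^sub>R (S ** W \<omega> ** S)"
  proof -
    have "AE \<omega> in P. psd (M i \<omega>) \<and> M i \<omega> ** Q = M i \<omega>" if "i \<in> {1..n}" for i
      using psd[OF that] AE_absorbs_range_projection[OF psd int mean S(4)[folded Q_def], OF that that that] by eventually_elim simp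
    then have "AE \<omega> in P. \<forall>i\<in>{1..n}. psd (M i \<omega>) \<and> M i \<omega> ** Q = M i \<omega>"
      by (intro AE_finite_allI) auto
    then show ?thesis
    proof eventually_elim
      case (elim \<omega>)
      have "S ** W \<omega> ** S = (\<Sum>i=1..n. M i \<omega> - \<Sigma>)"
        unfolding W_def sandwich_sum
      proof (intro sum.cong refl)
        fix i assume i: "i \<in> {1..n}"
        have "(\<integral>\<omega>'. T ** M i \<omega>' ** T \<partial>P) = T ** \<Sigma> ** T"
          using integral_bounded_linear[OF bounded_linear_sandwich int[OF i], of T] mean[OF i] by simp
        moreover have "S ** (T ** M i \<omega> ** T) ** S = M i \<omega>" using elim i by (intro sand) (auto simp: psd_def)
        moreover have "S ** (T ** \<Sigma> ** T) ** S = \<Sigma>"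
          using psd\<Sigma> S(4) by (intro sand) (auto simp: psd_def Q_def)
        ultimately show "S ** (T ** M i \<omega> ** T - (\<integral>\<omega>'. T ** M i \<omega>' ** T \<partial>P)) ** S = M i \<omega> - \<Sigma>"
          by (simp add: sandwich_diff)
      qed
      also have "\<dots> = real n *\<^sub>R H \<omega>"
        using n by (simp add: H_def sum_subtractf scaleR_diff_right sum_constant_scaleR del: sum_constant)
      finally have "S ** W \<omega> ** S = real n *\<^sub>R H \<omega>" .
      then have HW: "H \<omega> = (1 / real n) *\<^sub>R (S ** W \<omega> ** S)" using n by simp
      have tr: "linear (transpose :: real^'p^'p \<Rightarrow> _)" by (rule bounded_linear.linear[OF bounded_linear_transpose])
      have "transpose (H \<omega>) = H \<omega>"
        unfolding H_def linear_diff[OF tr] linear_scale[OF tr] linear_sum[OF tr]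
        using elim psd\<Sigma> by (simp add: psd_def)
      with HW show ?case by simp
    qed
  qed

  obtain B where B: "B \<in> sets P" "emeasure P B \<le> ennreal (exp (- t))"
    "\<And>\<omega> u. \<omega> \<in> space P - B \<Longrightarrow> norm u = 1 \<Longrightarrow> \<bar>(S *v u) \<bullet> (W \<omega> *v (S *v u))\<bar> \<le> real n * c"
  proof (cases "\<Sigma> = 0")
    case True
    have "S *v u = 0" for u
      using symmetric_inner[OF S(1), of u "S *v u"] by (simp add: matrix_vector_mul_assoc S(2) True)
    moreover have "s = 0" unfolding s_def using True opnorm_eq_0[of \<Sigma>] by blast
    then have "c = 0" by (simp add: c_def)
    ultimately show ?thesis by (intro that[of "{}"]) auto
  next
    case False
    have s: "s > 0" unfolding s_def using False opnorm_eq_0[of \<Sigma>] opnorm_nonneg[of \<Sigma>] by linarith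
    have rank: "eff_rank \<Sigma> = trace \<Sigma> / s" using s by (simp add: eff_rank_def s_def)
    have quad: "(norm (S *v u))\<^sup>2 = u \<bullet> (\<Sigma> *v u)" for u
      using symmetric_inner[OF S(1), of u "S *v u"] by (simp add: dot_square_norm matrix_vector_mul_assoc S(2))
    have Sb: "(norm (S *v u))\<^sup>2 \<le> s * (norm u)\<^sup>2" for u
    proof -
      have "u \<bullet> (\<Sigma> *v u) \<le> norm u * (s * norm u)"
        unfolding s_def by (intro order_trans[OF norm_cauchy_schwarz] mult_left_mono norm_matrix_vector_le) simp
      then show ?thesis unfolding quad by (simp add: power2_eq_square mult_ac)
    qed
    have F: "(\<Sum>b\<in>Basis. (norm (S *v b))\<^sup>2) = s * eff_rank \<Sigma>"
      using symmetric_frobenius(1)[OF S(1)] s by (simp add: S(2) rank)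
    have r1: "eff_rank \<Sigma> \<ge> 1"
    proof -
      have "s \<le> trace \<Sigma>"
        unfolding s_def
      proof (rule opnorm_symmetric_le)
        show "\<bar>x \<bullet> (\<Sigma> *v x)\<bar> \<le> trace \<Sigma> * (x \<bullet> x)" for x
          using symmetric_frobenius(2)[OF S(1), of x] by (simp add: quad[symmetric] S(2) dot_square_norm)
      qed (use psd\<Sigma> trace_psd_nonneg in \<open>auto simp: psd_def\<close>)
      then show ?thesis using s by (simp add: rank)
    qed
    have tb: "trace_bernstein P W K n"
    proof -
      have "trace (A ** W \<omega>) = (\<Sum>i=1..n. trace (A ** (T ** M i \<omega> ** T - (\<integral>\<omega>'. T ** M i \<omega>' ** T \<partial>P))))" for A \<omega>
      proof -
        have "bounded_linear (\<lambda>X. trace (A ** X))"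
          by (intro bounded_linear_compose[OF bounded_linear_trace] bounded_bilinear.bounded_linear_right bounded_bilinear_matrix_mult)
        from linear_sum[OF bounded_linear.linear[OF this]] show ?thesis by (simp add: W_def)
      qed
      then show ?thesis unfolding trace_bernstein_def using mgf[folded T_def] by simp
    qed
    have c': "12 * s * real n * sqrt (K * (9 * eff_rank \<Sigma> + 4 * t) / real n) = real n * c"
      by (simp add: c_def)
    show ?thesis
      by (rule uniform_quadratic_deviation[OF assms(1) Wm tb K n t s Sb F r1 large, unfolded c'], rule that)
  qed

  define E where "E = {\<omega> \<in> space P. opnorm (H \<omega>) \<le> c}"
  have E: "E \<in> sets P"
  proof -
    have "E = H -` {A. opnorm A \<le> c} \<inter> space P" by (auto simp: E_def)
    then show ?thesis using measurable_sets[OF Hm borel_closed[OF closed_opnorm_le]] by simp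
  qed
  have "AE \<omega> in P. \<omega> \<in> space P - E \<longrightarrow> \<omega> \<in> B"
    using H
  proof eventually_elim
    case (elim \<omega>)
    show ?case
    proof (rule ccontr)
      assume "\<not> (\<omega> \<in> space P - E \<longrightarrow> \<omega> \<in> B)"
      then have \<omega>: "\<omega> \<in> space P - B" "\<omega> \<notin> E" by auto
      have unit: "\<bar>u \<bullet> (H \<omega> *v u)\<bar> \<le> c" if "norm u = 1" for u
      proof -
        have "real n * (u \<bullet> (H \<omega> *v u)) = (S *v u) \<bullet> (W \<omega> *v (S *v u))"
          using elim n symmetric_inner[OF S(1)]
          by (simp add: scaleR_matrix_vector_assoc[symmetric] matrix_vector_mul_assoc[symmetric])
        then have "real n * \<bar>u \<bullet> (H \<omega> *v u)\<bar> \<le> real n * c"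
          using B(3)[OF \<omega>(1) that] by (metis abs_mult abs_of_nat)
        then show ?thesis using n by simp
      qed
      have "opnorm (H \<omega>) \<le> c"
      proof (rule opnorm_symmetric_le)
        show "transpose (H \<omega>) = H \<omega>" using elim by blast
        show "c \<ge> 0" using unit[of "axis undefined 1"] by (simp add: norm_axis_1)
        fix x
        show "\<bar>x \<bullet> (H \<omega> *v x)\<bar> \<le> c * (x \<bullet> x)"
        proof (cases "x = 0")
          case False
          define u where "u = x /\<^sub>R norm x"
          have x: "x = norm x *\<^sub>R u" using False by (simp add: u_def)
          have "x \<bullet> (H \<omega> *v x) = (norm x)\<^sup>2 * (u \<bullet> (H \<omega> *v u))"
            by (subst (1 2) x) (simp add: matrix_vector_mult_scaleR power2_eq_square)
          moreover have "\<bar>u \<bullet> (H \<omega> *v u)\<bar> \<le> c" using False by (intro unit) (simp add: u_def)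
          then have "(norm x)\<^sup>2 * \<bar>u \<bullet> (H \<omega> *v u)\<bar> \<le> (norm x)\<^sup>2 * c" by (rule mult_left_mono) simp
          ultimately show ?thesis by (simp add: abs_mult dot_square_norm mult.commute)
        qed simp
      qed
      with \<omega> show False by (simp add: E_def)
    qed
  qed
  then have "emeasure P (space P - E) \<le> emeasure P B" using B(1) by (intro emeasure_mono_AE) auto
  then have "ennreal (measure P (space P - E)) \<le> ennreal (exp (- t))"
    using B(2) by (simp add: P.emeasure_eq_measure)
  then have "measure P (space P - E) \<le> exp (- t)" by simp
  then have "1 - exp (- t) \<le> measure P E" using P.prob_compl[OF E] by simp
  then show ?thesis unfolding E_def H_def s_def[symmetric] c_eq .
qed

end
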